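(* Consider the time-invariant SUTSE model, and the Kalman filter run with correlations disregarded, as described in the context, and suppose Assumptions (1), (2), (3), (4) of the context hold. Then, as $t\to\infty$, $E(v_t')\to 0$, and there exists a $d\times d$ matrix $V_{v'}$ such that $V(v_t')\to V_{v'}$, where $V(v_t')$ denotes the (unconditional) covariance matrix of $v_t'$.
   Context: Model. Let $d\ge 1$, $p^{(1)},\dots,p^{(d)}\ge 1$, $p=p^{(1)}+\dots+p^{(d)}$. $Diag(\cdot)$ denotes a block-diagonal matrix. Let $Z=Diag(Z^{(1)},\dots,Z^{(d)})$ ($d\times p$, each $Z^{(j)}$ of size $1\times p^{(j)}$) and $T=Diag(T^{(1)},\dots,T^{(d)})$ ($p\times p$, each $T^{(j)}$ of size $p^{(j)}\times p^{(j)}$) be deterministic real matrices. The true model is, for $t=1,2,\dots$, $$y_t=Z\alpha_t+\varepsilon_t,\qquad \alpha_{t+1}=T\alpha_t+\eta_t,$$ with $\varepsilon_t\sim N(0,\Sigma_\varepsilon)$, $\eta_t\sim N(0,\Sigma_\eta)$, $\alpha_1\sim N(a_1,P_1)$, where $\alpha_1,\varepsilon_1,\varepsilon_2,\dots,\eta_1,\eta_2,\dots$ are jointly Gaussian and mutually uncorrelated (hence independent). Write $Y_t=\{y_1,\dots,y_t\}$. True Kalman filter. $a_t=E(\alpha_t|Y_{t-1})$, $P_t=V(\alpha_t|Y_{t-1})$, $v_t=y_t-Za_t$, $F_t=V(v_t|Y_{t-1})$; these satisfy, starting from $a_1,P_1$, $$F_t=ZP_tZ^T+\Sigma_\varepsilon,\quad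 K_t=P_tZ^TF_t^{-1},\quad L_t=I_p-K_tZ,\quad a_{t+1}=Ta_t+TK_tv_t,\quad P_{t+1}=TP_tL_t^TT^T+\Sigma_\eta .$$ Filter disregarding correlation. Let $\Sigma_\varepsilon'=Diag(\Sigma_\varepsilon(1,1),\dots,\Sigma_\varepsilon(d,d))$ and $\Sigma_\eta'=Diag(\Sigma_\eta^{(1)},\dots,\Sigma_\eta^{(d)})$, where $\Sigma_\eta^{(j)}$ is the $j$-th $p^{(j)}\times p^{(j)}$ diagonal block of $\Sigma_\eta$. Start from a deterministic vector $a_1'\in\mathbb R^p$ and a symmetric positive semidefinite block-diagonal $P_1'=Diag(P_1'^{(1)},\dots,P_1'^{(d)})$ (blocks of size $p^{(j)}\times p^{(j)}$), and define recursively (with the same data $y_t$) $$v_t'=y_t-Za_t',\quad F_t'=ZP_t'Z^T+\Sigma_\varepsilon',\quad K_t'=P_t'Z^TF_t'^{-1},\quad L_t'=I_p-K_t'Z,\quad a_{t+1}'=Ta_t'+TK_t'v_t',\quad P_{t+1}'=TP_t'L_t'^TT^T+\Sigma_\eta'.$$ Assumptions. $\|A\|_F=\sqrt{tr(AA^T)}$ is the Frobenius norm; matrix convergence is in this norm. Products are ordered: $\prod_{i=k}^{l}TL'_{t-i}=TL'_{t-k}\,TL'_{t-k-1}\cdots TL'_{t-l}$. (1) $\Sigma_\varepsilon$ and $\Sigma_\varepsilon'$ are positive definite. (2) The matrix $(Z^T,(ZT)^T,\dots,(ZT^{p-1})^T)^T$ has rank $p$. (3) $\Sigma_\eta=RQR^T$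 with $R$ of size $p\times r$ and $Q$ an $r\times r$ positive definite matrix, and $(R,TR,\dots,T^{p-1}R)$ has rank $p$; similarly $\Sigma_\eta'=R'Q'R'^T$ with $R'$ of size $p\times r'$ and $Q'$ an $r'\times r'$ positive definite matrix, and $(R',TR',\dots,T^{p-1}R')$ has rank $p$. (4) There is $M>0$ such that for all $t\ge 1$ and all $0\le k\le l\le t-1$, $\|\prod_{i=k}^{l}TL'_{t-i}\|_F\le M$. *)

theory Defs
  imports "HOL-Probability.Probability"
begin

section \<open>Matrices\<close>

text \<open>\<open>real^'n^'m\<close> without the sort that its syntax attaches to index variables, which would clash
  with a linear order on the index type.\<close>

type_synonym 'n rvec = "(real, 'n) vec"
type_synonym ('m, 'n) rmat = "((real, 'n) vec, 'm) vec"

text \<open>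
  The block structure of a matrix is given by two labellings, sending each row index and each
  column index to its block. The labelling of the state coordinates is a monotone surjection
  \<open>blk\<close> onto the index type of the series, so the blocks are consecutive and
  \<open>card {i. blk i = j}\<close> is the size of the \<open>j\<close>-th one; observation \<open>j\<close> is its own block.
\<close>

definition block_diag :: "('m \<Rightarrow> 'b) \<Rightarrow> ('n \<Rightarrow> 'b) \<Rightarrow> real^'n^'m \<Rightarrow> bool" where
  "block_diag rb cb A \<longleftrightarrow> (\<forall>i j. rb i \<noteq> cb j \<longrightarrow> A $ i $ j = 0)"

definition block_part :: "('m \<Rightarrow> 'b) \<Rightarrow> ('n \<Rightarrow> 'b) \<Rightarrow> real^'n^'m \<Rightarrow> real^'n^'m" where
  "block_part rb cb A = (\<chi> i j. if rb i = cb j then A $ i $ j else 0)"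

definition pos_semidef :: "real^'n^'n \<Rightarrow> bool" where
  "pos_semidef A \<longleftrightarrow> transpose A = A \<and> (\<forall>x. 0 \<le> x \<bullet> (A *v x))"

definition pos_def :: "real^'n^'n \<Rightarrow> bool" where
  "pos_def A \<longleftrightarrow> transpose A = A \<and> (\<forall>x. x \<noteq> 0 \<longrightarrow> 0 < x \<bullet> (A *v x))"

definition frob_norm :: "real^'n^'m \<Rightarrow> real" where
  "frob_norm A = sqrt (trace (A ** transpose A))"

text \<open>The norm carried by the matrix types is the Frobenius norm, so library convergence of
  matrices is convergence in Frobenius norm.\<close>

lemma frob_norm_eq_norm: "frob_norm A = norm A"
  unfolding frob_norm_def norm_eq_sqrt_inner
  by (simp add: trace_def matrix_matrix_mult_def transpose_def inner_vec_def)

text \<open>Not \<open>A ^ k\<close>, which is the componentwise power on vector types.\<close>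

primrec matpow :: "real^'n^'n \<Rightarrow> nat \<Rightarrow> real^'n^'n" where
  "matpow A 0 = mat 1"
| "matpow A (Suc k) = A ** matpow A k"

text \<open>\<open>ordprod B k l = B k ** B (k + 1) ** \<dots> ** B l\<close>\<close>

definition ordprod :: "(nat \<Rightarrow> real^'n^'n) \<Rightarrow> nat \<Rightarrow> nat \<Rightarrow> real^'n^'n" where
  "ordprod B k l = foldr (\<lambda>i C. B i ** C) [k..<Suc l] (mat 1)"

text \<open>
  With \<open>p = CARD('p)\<close>, \<open>rank_pos\<close> numbers the state coordinates \<open>0, \<dots>, p - 1\<close>. Row \<open>(k, j)\<close> of
  the observability matrix is row \<open>j\<close> of \<open>Z T\<^sup>k\<close>; column \<open>(k, l)\<close> of the controllability matrix
  is column \<open>l\<close> of \<open>T\<^sup>k R\<close>.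
\<close>

definition rank_pos :: "'p::{finite,linorder} \<Rightarrow> nat" where
  "rank_pos k = card {i. i < k}"

definition obs_matrix ::
  "('d::finite, 'p::{finite,linorder}) rmat \<Rightarrow> ('p, 'p) rmat \<Rightarrow> ('p \<times> 'd, 'p) rmat" where
  "obs_matrix Z T = (\<chi> kj. (Z ** matpow T (rank_pos (fst kj))) $ snd kj)"

definition ctrl_matrix ::
  "('p::{finite,linorder}, 'p) rmat \<Rightarrow> ('p, 'r::finite) rmat \<Rightarrow> ('p, 'p \<times> 'r) rmat" where
  "ctrl_matrix T R = (\<chi> i kl. (matpow T (rank_pos (fst kl)) ** R) $ i $ snd kl)"

section \<open>Gaussian vectors and covariances\<close>

text \<open>The normal distribution with mean \<open>m\<close> and variance \<open>v \<ge> 0\<close>; a point mass if \<open>v = 0\<close>.\<close>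

definition normal_measure :: "real \<Rightarrow> real \<Rightarrow> real measure" where
  "normal_measure m v =
     (if v = 0 then return borel m
      else density lborel (\<lambda>x. ennreal (normal_density m (sqrt v) x)))"

definition gaussian_vector ::
  "'w measure \<Rightarrow> ('w \<Rightarrow> real^'n) \<Rightarrow> real^'n \<Rightarrow> real^'n^'n \<Rightarrow> bool" where
  "gaussian_vector M X \<mu> S \<longleftrightarrow>
     X \<in> borel_measurable M \<and> pos_semidef S \<and>
     (\<forall>c. distr M borel (\<lambda>\<omega>. c \<bullet> X \<omega>) = normal_measure (c \<bullet> \<mu>) (c \<bullet> (S *v c)))"

text \<open>Joint Gaussianity of \<open>X\<close>, \<open>U 1, U 2, \<dots>\<close>, \<open>W 1, W 2, \<dots>\<close>: every finite linear combination
  of their coordinates is normal, possibly degenerate.\<close>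

definition jointly_gaussian ::
  "'w measure \<Rightarrow> ('w \<Rightarrow> real^'n) \<Rightarrow> (nat \<Rightarrow> 'w \<Rightarrow> real^'m) \<Rightarrow> (nat \<Rightarrow> 'w \<Rightarrow> real^'k) \<Rightarrow> bool" where
  "jointly_gaussian M X U W \<longleftrightarrow>
     X \<in> borel_measurable M \<and>
     (\<forall>t\<ge>1. U t \<in> borel_measurable M) \<and> (\<forall>t\<ge>1. W t \<in> borel_measurable M) \<and>
     (\<forall>n a b c. \<exists>m v. 0 \<le> v \<and>
        distr M borel (\<lambda>\<omega>. a \<bullet> X \<omega> + (\<Sum>t=1..n. b t \<bullet> U t \<omega> + c t \<bullet> W t \<omega>)) = normal_measure m v)"

definition cov_matrix ::
  "'w measure \<Rightarrow> ('w \<Rightarrow> real^'m) \<Rightarrow> ('w \<Rightarrow> real^'n) \<Rightarrow> real^'n^'m" where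
  "cov_matrix M X Y =
     (\<chi> i j. LINT \<omega>|M. (X \<omega> $ i - (LINT \<omega>|M. X \<omega>) $ i) * (Y \<omega> $ j - (LINT \<omega>|M. Y \<omega>) $ j))"

abbreviation uncorrelated ::
  "'w measure \<Rightarrow> ('w \<Rightarrow> real^'m) \<Rightarrow> ('w \<Rightarrow> real^'n) \<Rightarrow> bool" where
  "uncorrelated M X Y \<equiv> cov_matrix M X Y = 0"

section \<open>The Kalman recursions\<close>

text \<open>\<open>P\<close> stands for the current state variance, \<open>Se\<close> and \<open>Sh\<close> for the observation and state noise
  variances used by the filter.\<close>

definition kf_F :: "real^'p^'d \<Rightarrow> real^'d^'d \<Rightarrow> real^'p^'p \<Rightarrow> real^'d^'d" where
  "kf_F Z Se P = Z ** P ** transpose Z + Se"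

definition kf_K :: "real^'p^'d \<Rightarrow> real^'d^'d \<Rightarrow> real^'p^'p \<Rightarrow> real^'d^'p" where
  "kf_K Z Se P = P ** transpose Z ** matrix_inv (kf_F Z Se P)"

definition kf_L :: "real^'p^'d \<Rightarrow> real^'d^'d \<Rightarrow> real^'p^'p \<Rightarrow> real^'p^'p" where
  "kf_L Z Se P = mat 1 - kf_K Z Se P ** Z"

text \<open>Time starts at \<open>1\<close>; the values at time \<open>0\<close> are dummies.\<close>

primrec kf_P :: "real^'p^'d \<Rightarrow> real^'p^'p \<Rightarrow> real^'d^'d \<Rightarrow> real^'p^'p \<Rightarrow> real^'p^'p
    \<Rightarrow> nat \<Rightarrow> real^'p^'p" where
  "kf_P Z T Se Sh P1 0 = P1"
| "kf_P Z T Se Sh P1 (Suc t) =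
     (if t = 0 then P1
      else T ** kf_P Z T Se Sh P1 t ** transpose (kf_L Z Se (kf_P Z T Se Sh P1 t)) ** transpose T
           + Sh)"

primrec kf_a :: "real^'p^'d \<Rightarrow> real^'p^'p \<Rightarrow> real^'d^'d \<Rightarrow> real^'p^'p \<Rightarrow> real^'p \<Rightarrow> real^'p^'p
    \<Rightarrow> (nat \<Rightarrow> real^'d) \<Rightarrow> nat \<Rightarrow> real^'p" where
  "kf_a Z T Se Sh a1 P1 y 0 = a1"
| "kf_a Z T Se Sh a1 P1 y (Suc t) =
     (if t = 0 then a1
      else T *v kf_a Z T Se Sh a1 P1 y t
           + (T ** kf_K Z Se (kf_P Z T Se Sh P1 t)) *v (y t - Z *v kf_a Z T Se Sh a1 P1 y t))"

definition kf_v :: "real^'p^'d \<Rightarrow> real^'p^'p \<Rightarrow> real^'d^'d \<Rightarrow> real^'p^'p \<Rightarrow> real^'p \<Rightarrow> real^'p^'p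
    \<Rightarrow> (nat \<Rightarrow> real^'d) \<Rightarrow> nat \<Rightarrow> real^'d" where
  "kf_v Z T Se Sh a1 P1 y t = y t - Z *v kf_a Z T Se Sh a1 P1 y t"

end

(* The error x_t = alpha_t - a'_t of the mis-specified filter satisfies
   x_{t+1} = T L'_t x_t + eta_t - T K'_t epsilon_t, so its mean and variance obey linear recursions
   with coefficient T L'_t, and v'_t = Z x_t + epsilon_t. It suffices that P'_t converges to a matrix
   P whose closed loop matrix T L is stable.

   The Riccati map is a minimum over gains of quadratic forms, hence monotone. Its iterates from 0
   therefore increase; observability bounds them, because w can be steered to 0 at a finite cost,
   and their limit P is a fixed point. Along w, (T L)^T w, ((T L)^T)^2 w, ... the quadratic form of P
   decreases by the costs of the noises; these tend to 0, so by controllability the sequence does.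
   Finally P'_t - P = (T L'_{t-1}) ... (T L'_1) (P'_1 - P) ((T L)^T)^{t-1}, where the product on the left
   is bounded by Assumption (4). *)

theory Submission
  imports Defs
begin

subsection \<open>Matrix algebra\<close>

text \<open>A Riccati iterate is read as the value of a dual control problem: under an input u the
  state w moves to \<open>transpose T *v w - transpose Z *v u\<close>, at the cost
  \<open>w \<bullet> (Sh *v w) + u \<bullet> (Se *v u)\<close>, and the filter gain is the optimal
  feedback. This is why transposed matrices act on w throughout. Monotonicity handles the iterates
  from 0 only; those from an arbitrary positive semidefinite start need not be monotone. They are
  compared with the fixed point through an exact factorisation of the difference of two Riccati
  steps, which carries the closed loop matrix of one solution on the left and that of the other on
  the right, without a quadratic remainder. Hence decay of one side and boundedness of the other
  suffice. A stable matrix need not contract in norm, so recursions whose coefficients merely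
  converge to it are measured in an adapted norm. The variance of x_t follows a Lyapunov recursion,
  not a Riccati one: its coefficients come from the filter, while its forcing term also contains the
  true noise variances.\<close>

declare transpose_matrix_vector [simp del]

lemma matrix_diff_ldistrib: "A ** (B - C) = A ** B - A ** (C :: real^'n^'m)"
  by (metis add_diff_cancel_right' diff_add_cancel matrix_add_ldistrib)

lemma matrix_diff_rdistrib: "(A - B) ** C = A ** C - B ** (C :: real^'n^'m)"
  by (simp add: matrix_matrix_mult_def vec_eq_iff left_diff_distrib sum_subtractf)

lemma matrix_add_rdistrib: "(A + B) ** C = A ** C + B ** (C :: real^'n^'m)"
  by (simp add: matrix_matrix_mult_def vec_eq_iff distrib_right sum.distrib)

lemma transpose_add: "transpose (A + B) = transpose A + transpose B"
  by (simp add: transpose_def vec_eq_iff)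

lemma transpose_diff: "transpose (A - B) = transpose A - transpose B"
  by (simp add: transpose_def vec_eq_iff)

lemma inner_matrix_vector: "x \<bullet> (A *v y) = (transpose A *v x) \<bullet> (y :: real^'n)"
  by (simp add: dot_lmul_matrix transpose_matrix_vector)

lemma symmetric_matrix_swap:
  "transpose A = A \<Longrightarrow> x \<bullet> (A *v y) = (A *v x) \<bullet> (y :: real^'n)"
  by (metis inner_matrix_vector)

section \<open>Continuity of the matrix operations\<close>

lemma bilinear_matrix_mult: "bilinear ((**) :: real^'n^'m \<Rightarrow> real^'k^'n \<Rightarrow> real^'k^'m)"
  unfolding bilinear_def
  by (intro conjI allI linearI)
    (simp_all add: matrix_add_ldistrib matrix_add_rdistrib matrix_scaleR vec_eq_iff
      matrix_matrix_mult_def sum_distrib_left sum.distrib algebra_simps)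

lemma bounded_bilinear_matrix_mult:
  "bounded_bilinear ((**) :: real^'n^'m \<Rightarrow> real^'k^'n \<Rightarrow> real^'k^'m)"
  using bilinear_matrix_mult bilinear_conv_bounded_bilinear by blast

lemma bounded_bilinear_matrix_vector_mult:
  "bounded_bilinear ((*v) :: real^'n^'m \<Rightarrow> real^'n \<Rightarrow> real^'m)"
  unfolding bilinear_conv_bounded_bilinear[symmetric] bilinear_def
  by (intro conjI allI linearI)
    (simp_all add: vec_eq_iff matrix_vector_mult_def sum_distrib_left sum.distrib algebra_simps)

lemmas tendsto_matrix_mult [tendsto_intros] =
  bounded_bilinear.tendsto[OF bounded_bilinear_matrix_mult]

lemmas tendsto_matrix_vector_mult [tendsto_intros] =
  bounded_bilinear.tendsto[OF bounded_bilinear_matrix_vector_mult]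

lemma bounded_linear_transpose: "bounded_linear (transpose :: real^'n^'m \<Rightarrow> real^'m^'n)"
  unfolding linear_conv_bounded_linear[symmetric]
  by (intro linearI) (simp_all add: transpose_add transpose_scalar)

lemmas tendsto_transpose [tendsto_intros] = bounded_linear.tendsto[OF bounded_linear_transpose]

lemma matrix_eq_inner:
  fixes A B :: "real^'n^'m"
  assumes "\<And>x y. x \<bullet> (A *v y) = x \<bullet> (B *v y)"
  shows "A = B"
  using assms by (metis matrix_eq vector_eq_ldot)

lemma matrix_component_inner: "(A :: real^'n^'m) $ i $ j = axis i 1 \<bullet> (A *v axis j 1)"
  by (simp add: inner_axis' matrix_vector_mult_basis column_def)

text \<open>Each entry is the bilinear form at two axis vectors, so in finite dimension it is enough
  to follow the orbits of single vectors.\<close>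

lemma tendsto_matrixI:
  fixes X :: "nat \<Rightarrow> real^'n^'m"
  assumes "\<And>x. (\<lambda>t. X t *v x) \<longlonglongrightarrow> A *v x"
  shows "X \<longlonglongrightarrow> A"
  by (intro vec_tendstoI) (simp only: matrix_component_inner, intro tendsto_intros assms)

lemma matpow_Suc_right: "matpow A (Suc k) = matpow A k ** A"
  by (induction k) (simp_all add: matrix_mul_assoc)

lemma transpose_matpow: "transpose (matpow A k) = matpow (transpose A) k"
  by (induction k) (simp, simp only: matpow.simps(2), metis matpow.simps(2) matpow_Suc_right matrix_transpose_mul)

lemma matpow_vec_Suc: "matpow A (Suc k) *v x = matpow A k *v (A *v x)"
  by (induction k) (simp_all add: matrix_vector_mul_assoc[symmetric])

lemma transpose_zero [simp]: "transpose 0 = 0"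
  by (simp add: transpose_def vec_eq_iff)

section \<open>Semidefinite matrices, coercivity and limits\<close>

lemma pos_semidef_zero: "pos_semidef 0"
  by (simp add: pos_semidef_def)

lemma pos_def_imp_pos_semidef: "pos_def A \<Longrightarrow> pos_semidef A"
  unfolding pos_def_def pos_semidef_def by (metis inner_zero_left order.refl order_less_imp_le)

lemma pos_semidef_congruence:
  assumes "pos_semidef (S :: real^'n^'n)"
  shows "pos_semidef ((A :: real^'n^'m) ** S ** transpose A)"
proof -
  have "x \<bullet> ((A ** S ** transpose A) *v x) = (transpose A *v x) \<bullet> (S *v (transpose A *v x))" for x
    by (simp add: inner_matrix_vector matrix_vector_mul_assoc[symmetric])
  then show ?thesis
    using assms unfolding pos_semidef_def by (simp add: matrix_transpose_mul matrix_mul_assoc)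
qed

lemma pos_def_add: "pos_semidef A \<Longrightarrow> pos_def B \<Longrightarrow> pos_def (A + B)"
  unfolding pos_semidef_def pos_def_def
  by (simp add: transpose_add matrix_vector_mult_add_rdistrib inner_add_right add_nonneg_pos)

text \<open>The form attains a positive minimum on the compact unit sphere; homogeneity of degree
  two carries this bound to every x.\<close>

lemma pos_def_lower_bound:
  assumes "pos_def (S :: real^'n^'n)"
  obtains c where "c > 0" "\<And>x. c * (norm x)\<^sup>2 \<le> x \<bullet> (S *v x)"
proof -
  have "continuous_on (sphere 0 1) (\<lambda>x. x \<bullet> (S *v x))"
    by (intro continuous_intros)
  moreover have "sphere 0 1 \<noteq> ({} :: (real^'n) set)"
    by (simp add: sphere_eq_empty)
  ultimately obtain x0 :: "real^'n" where x0: "norm x0 = 1"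
      "\<And>x. norm x = 1 \<Longrightarrow> x0 \<bullet> (S *v x0) \<le> x \<bullet> (S *v x)"
    using continuous_attains_inf[OF compact_sphere[of "0 :: real^'n" 1], of "\<lambda>x. x \<bullet> (S *v x)"]
    by auto
  have bnd: "x0 \<bullet> (S *v x0) * (norm x)\<^sup>2 \<le> x \<bullet> (S *v x)" for x
  proof (cases "x = 0")
    case False
    define u where "u = (1 / norm x) *\<^sub>R x"
    have "x = norm x *\<^sub>R u" "norm u = 1" using False by (auto simp: u_def)
    then have "x \<bullet> (S *v x) = (norm x)\<^sup>2 * (u \<bullet> (S *v u))"
      by (metis (no_types, lifting) inner_scaleR_left inner_scaleR_right matrix_vector_mult_scaleR
          mult.assoc power2_eq_square)
    then show ?thesis using x0(2)[OF \<open>norm u = 1\<close>] by (simp add: mult.commute[of _ "(norm x)\<^sup>2"] mult_left_mono)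
  qed simp
  moreover have "x0 \<bullet> (S *v x0) > 0"
    using assms x0(1) unfolding pos_def_def by (metis norm_zero zero_neq_one)
  ultimately show ?thesis using that by blast
qed

lemma pos_def_invertible:
  assumes "pos_def (S :: real^'n^'n)"
  shows "invertible S"
proof -
  have "x = 0" if "S *v x = 0" for x
    using assms that unfolding pos_def_def by (metis inner_zero_right less_irrefl)
  then show ?thesis
    using invertible_left_inverse matrix_left_invertible_ker by blast
qed

lemma tendsto_zero_of_norm_square_le:
  fixes x :: "nat \<Rightarrow> 'a::real_normed_vector"
  assumes "c > 0" and le: "\<And>t. c * (norm (x t))\<^sup>2 \<le> f t" and "f \<longlonglongrightarrow> 0"
  shows "x \<longlonglongrightarrow> 0"
proof -
  have "(\<lambda>t. sqrt (f t / c)) \<longlonglongrightarrow> sqrt (0 / c)"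
    by (intro tendsto_intros assms) (use \<open>c > 0\<close> in simp)
  then have lim: "(\<lambda>t. sqrt (f t / c)) \<longlonglongrightarrow> 0" by simp
  have "norm (x t) \<le> sqrt (f t / c)" for t
    using \<open>c > 0\<close> le[of t] by (intro real_le_rsqrt) (simp add: pos_le_divide_eq mult.commute)
  then show ?thesis by (intro Lim_null_comparison[OF _ lim] always_eventually allI)
qed

lemma matrix_inv_mult:
  assumes "invertible (A :: real^'n^'n)"
  shows "A ** matrix_inv A = mat 1" "matrix_inv A ** A = mat 1"
  using assms unfolding invertible_def matrix_inv_def by (metis (mono_tags, lifting) someI_ex)+

text \<open>Coercivity bounds the inverses uniformly, and then the resolvent identity
  \<open>A\<inverse> - B\<inverse> = A\<inverse> (B - A) B\<inverse>\<close> gives convergence.\<close>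

lemma tendsto_matrix_inv:
  fixes F :: "nat \<Rightarrow> real^'n^'n"
  assumes lim: "F \<longlonglongrightarrow> G" and c: "c > 0"
    and coercive: "\<And>t x. c * (norm x)\<^sup>2 \<le> x \<bullet> (F t *v x)" "\<And>x. c * (norm x)\<^sup>2 \<le> x \<bullet> (G *v x)"
  shows "(\<lambda>t. matrix_inv (F t)) \<longlonglongrightarrow> matrix_inv G"
proof -
  have inv: "invertible A" if "\<And>x. c * (norm x)\<^sup>2 \<le> x \<bullet> (A *v x)" for A :: "real^'n^'n"
  proof -
    have "x = 0" if "A *v x = 0" for x
    proof -
      have "c * (norm x)\<^sup>2 \<le> 0"
        using \<open>\<And>x. c * (norm x)\<^sup>2 \<le> x \<bullet> (A *v x)\<close>[of x] that by simp
      then show ?thesis using c by (simp add: mult_le_0_iff)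
    qed
    then show ?thesis using invertible_left_inverse matrix_left_invertible_ker by blast
  qed
  have bnd: "norm (matrix_inv A *v y) \<le> norm y / c"
    if A: "\<And>x. c * (norm x)\<^sup>2 \<le> x \<bullet> (A *v x)" for A :: "real^'n^'n" and y
  proof -
    define x where "x = matrix_inv A *v y"
    have "A *v x = y" using matrix_inv_mult(1)[OF inv[OF A]]
      by (simp add: x_def matrix_vector_mul_assoc)
    then have "c * (norm x)\<^sup>2 \<le> norm x * norm y"
      using A[of x] norm_cauchy_schwarz[of x y] by simp
    then have "c * norm x \<le> norm y"
      by (cases "x = 0") (simp_all add: power2_eq_square mult.left_commute)
    then show ?thesis using c by (simp add: x_def field_simps)
  qed
  have diff: "matrix_inv (F t) *v x - matrix_inv G *v x =
      matrix_inv (F t) *v ((G - F t) *v (matrix_inv G *v x))" for t x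
  proof -
    have "matrix_inv (F t) ** ((G - F t) ** matrix_inv G) = matrix_inv (F t) - matrix_inv G"
      using matrix_inv_mult[OF inv[OF coercive(1)]] matrix_inv_mult[OF inv[OF coercive(2)]]
      by (simp add: matrix_diff_ldistrib matrix_diff_rdistrib matrix_mul_assoc)
    then show ?thesis
      by (metis matrix_vector_mul_assoc matrix_vector_mult_diff_rdistrib)
  qed
  have vec: "(\<lambda>t. matrix_inv (F t) *v x) \<longlonglongrightarrow> matrix_inv G *v x" for x
  proof (rule Lim_transform2[OF tendsto_const])
    have *: "(\<lambda>t. norm ((G - F t) *v (matrix_inv G *v x)) / c) \<longlonglongrightarrow> norm ((G - G) *v (matrix_inv G *v x)) / c"
      by (intro tendsto_intros lim) (use c in simp)
    have "(\<lambda>t. matrix_inv (F t) *v x - matrix_inv G *v x) \<longlonglongrightarrow> 0"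
      by (rule Lim_null_comparison[OF _ *[simplified]]) (simp add: diff bnd[OF coercive(1)])
    then show "(\<lambda>t. matrix_inv G *v x - matrix_inv (F t) *v x) \<longlonglongrightarrow> 0"
      using tendsto_minus by fastforce
  qed
  then show ?thesis by (rule tendsto_matrixI)
qed

text \<open>Polarisation: the entries of a symmetric matrix are fixed linear combinations of values
  of its quadratic form. The limit matrix \<open>A\<close> is built from the limits \<open>q\<close>
  in the same way.\<close>

lemma convergent_symmetric_matrix:
  fixes X :: "nat \<Rightarrow> real^'n^'n"
  assumes sym: "\<And>t. transpose (X t) = X t" and conv: "\<And>w. convergent (\<lambda>t. w \<bullet> (X t *v w))"
  shows "convergent X"
proof -
  define q where "q w = lim (\<lambda>t. w \<bullet> (X t *v w))" for w
  have q: "(\<lambda>t. w \<bullet> (X t *v w)) \<longlonglongrightarrow> q w" for w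
    using conv unfolding q_def convergent_LIMSEQ_iff by blast
  define A :: "real^'n^'n" where
    "A = (\<chi> i j. (q (axis i 1 + axis j 1) - q (axis i 1) - q (axis j 1)) / 2)"
  have "X t $ i $ j = ((axis i 1 + axis j 1) \<bullet> (X t *v (axis i 1 + axis j 1))
      - axis i 1 \<bullet> (X t *v axis i 1) - axis j 1 \<bullet> (X t *v axis j 1)) / 2" for t i j
    using symmetric_matrix_swap[OF sym, of "axis j 1" t "axis i 1"]
      matrix_component_inner[of "X t" i j]
    by (simp add: matrix_vector_right_distrib inner_add_left inner_add_right inner_commute)
  then have "X \<longlonglongrightarrow> A"
    by (intro vec_tendstoI) (simp only: A_def vec_lambda_beta, intro tendsto_intros q, simp)
  then show ?thesis by (rule convergentI)
qed

lemma pos_semidef_limit: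
  assumes "\<And>t. pos_semidef (X t)" "X \<longlonglongrightarrow> (A :: real^'n^'n)"
  shows "pos_semidef A"
proof -
  have "X \<longlonglongrightarrow> transpose A"
    using tendsto_transpose[OF assms(2)] assms(1) by (simp add: pos_semidef_def)
  then have "transpose A = A" using assms(2) LIMSEQ_unique by blast
  moreover have "0 \<le> x \<bullet> (A *v x)" for x
  proof (rule LIMSEQ_le_const)
    show "(\<lambda>t. x \<bullet> (X t *v x)) \<longlonglongrightarrow> x \<bullet> (A *v x)" by (intro tendsto_intros assms)
  qed (use assms(1) in \<open>auto simp: pos_semidef_def\<close>)
  ultimately show ?thesis by (simp add: pos_semidef_def)
qed

subsection \<open>The Riccati recursion\<close>

definition riccati_step ::
  "real^'p^'d \<Rightarrow> real^'p^'p \<Rightarrow> real^'d^'d \<Rightarrow> real^'p^'p \<Rightarrow> real^'p^'p \<Rightarrow> real^'p^'p" where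
  "riccati_step Z T Se Sh P = T ** P ** transpose (kf_L Z Se P) ** transpose T + Sh"

text \<open>The filter starts at time 1, so time \<open>Suc t\<close> is reached after
  \<open>t\<close> steps.\<close>

lemma kf_P_Suc: "kf_P Z T Se Sh P1 (Suc t) = (riccati_step Z T Se Sh ^^ t) P1"
  by (induction t) (simp_all add: riccati_step_def)

locale riccati =
  fixes Z :: "real^'p^'d" and T :: "real^'p^'p" and Se :: "real^'d^'d" and Sh :: "real^'p^'p"
  assumes Se: "pos_def Se" and Sh: "pos_semidef Sh"
begin

abbreviation "step \<equiv> riccati_step Z T Se Sh"
abbreviation "F \<equiv> kf_F Z Se"
abbreviation "K \<equiv> kf_K Z Se"
abbreviation "L \<equiv> kf_L Z Se"

text \<open>The optimal input of the dual control problem in state w when the next state is charged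
  by the form of P; \<open>step_quadratic\<close> shows its optimality.\<close>

definition gain :: "real^'p^'p \<Rightarrow> real^'p \<Rightarrow> real^'d" where
  "gain P w = transpose (K P) *v (transpose T *v w)"

lemma pos_def_F: "pos_semidef P \<Longrightarrow> pos_def (F P)"
  unfolding kf_F_def by (intro pos_def_add pos_semidef_congruence Se)

lemma K_mult_F:
  assumes "pos_semidef P"
  shows "K P ** F P = P ** transpose Z"
  using matrix_inv_mult(2)[OF pos_def_invertible[OF pos_def_F[OF assms]]]
  by (simp add: kf_K_def flip: matrix_mul_assoc)

text \<open>Substituting \<open>Z ** P ** transpose Z = F P - Se\<close> removes the inverse and
  leaves \<open>Se\<close> alone. In this shape the mixed terms of two different solutions can be
  compared.\<close>

lemma L_mult_P_mult_transpose_Z: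
  assumes "pos_semidef P"
  shows "L P ** P ** transpose Z = K P ** Se"
proof -
  have "L P ** P ** transpose Z = P ** transpose Z - K P ** (Z ** P ** transpose Z)"
    by (simp add: kf_L_def matrix_diff_rdistrib matrix_mul_assoc)
  also have "Z ** P ** transpose Z = F P - Se" by (simp add: kf_F_def)
  finally show ?thesis by (simp add: matrix_diff_ldistrib K_mult_F[OF assms])
qed

text \<open>The right-hand side of the first identity is symmetric; transposing it yields the
  second.\<close>

lemma P_mult_transpose_L:
  assumes "pos_semidef P"
  shows "P ** transpose (L P) = P - K P ** F P ** transpose (K P)"
    and "P ** transpose (L P) = L P ** P"
proof -
  have sP: "transpose P = P" and sF: "transpose (F P) = F P"
    using assms pos_def_F[OF assms] by (simp_all add: pos_semidef_def pos_def_def)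
  show 1: "P ** transpose (L P) = P - K P ** F P ** transpose (K P)"
    by (simp add: kf_L_def transpose_diff matrix_diff_ldistrib matrix_transpose_mul
        matrix_mul_assoc K_mult_F[OF assms])
  then have "transpose (P ** transpose (L P)) = P ** transpose (L P)"
    by (simp add: transpose_diff matrix_transpose_mul sP sF matrix_mul_assoc)
  then show "P ** transpose (L P) = L P ** P"
    by (simp add: matrix_transpose_mul sP)
qed

text \<open>Completion of the square in u: the right-hand side is the cost of the input u followed
  by the charge P on the next state. Its Hessian form is that of \<open>F P\<close>, its minimiser
  is \<open>gain P w\<close>, and the minimum is the form of \<open>step P\<close>.\<close>

lemma step_quadratic:
  assumes "pos_semidef P"
  shows "w \<bullet> (step P *v w) + (u - gain P w) \<bullet> (F P *v (u - gain P w)) =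
    w \<bullet> (Sh *v w) + u \<bullet> (Se *v u) +
    (transpose T *v w - transpose Z *v u) \<bullet> (P *v (transpose T *v w - transpose Z *v u))"
proof -
  define x where "x = transpose T *v w"
  define g where "g = transpose (K P) *v x"
  have sP: "transpose P = P" and sF: "transpose (F P) = F P"
    using assms pos_def_F[OF assms] by (simp_all add: pos_semidef_def pos_def_def)
  \<comment> \<open>The stationarity condition of the minimiser. It turns every term that is mixed
    in u and x into \<open>u \<bullet> (F P *v g)\<close>.\<close>
  have Fg: "F P *v g = Z *v (P *v x)"
  proof -
    have "F P ** transpose (K P) = Z ** P"
      using arg_cong[OF K_mult_F[OF assms], of transpose] by (simp add: matrix_transpose_mul sP sF)
    then show ?thesis by (simp add: g_def matrix_vector_mul_assoc)
  qed
  have 1: "w \<bullet> (step P *v w) = w \<bullet> (Sh *v w) + x \<bullet> (P *v x) - g \<bullet> (F P *v g)"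
  proof -
    have "w \<bullet> (step P *v w) =
        w \<bullet> (Sh *v w) + x \<bullet> ((P ** transpose (L P)) *v x)"
      by (simp add: riccati_step_def matrix_vector_mult_add_rdistrib inner_add_right x_def
          inner_matrix_vector[of w T] matrix_vector_mul_assoc[symmetric])
    also have "x \<bullet> ((P ** transpose (L P)) *v x) = x \<bullet> (P *v x) - g \<bullet> (F P *v g)"
      unfolding P_mult_transpose_L(1)[OF assms]
      by (simp add: matrix_vector_mult_diff_rdistrib inner_diff_right g_def
          inner_matrix_vector[of x "K P"] matrix_vector_mul_assoc[symmetric])
    finally show ?thesis by simp
  qed
  have 2: "(u - g) \<bullet> (F P *v (u - g)) =
      u \<bullet> (F P *v u) - 2 * (u \<bullet> (F P *v g)) + g \<bullet> (F P *v g)"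
    using symmetric_matrix_swap[OF sF, of g u]
    by (simp add: matrix_vector_mult_diff_distrib inner_diff_left inner_diff_right inner_commute)
  have 3: "(x - transpose Z *v u) \<bullet> (P *v (x - transpose Z *v u)) =
      x \<bullet> (P *v x) - 2 * (u \<bullet> (F P *v g)) + (u \<bullet> (F P *v u) - u \<bullet> (Se *v u))"
  proof -
    have "(transpose Z *v u) \<bullet> (P *v x) = u \<bullet> (F P *v g)"
      by (simp add: Fg inner_matrix_vector[of u Z])
    moreover have "x \<bullet> (P *v (transpose Z *v u)) = (transpose Z *v u) \<bullet> (P *v x)"
      using symmetric_matrix_swap[OF sP] by (metis inner_commute)
    moreover have "(transpose Z *v u) \<bullet> (P *v (transpose Z *v u)) = u \<bullet> (F P *v u) - u \<bullet> (Se *v u)"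
      by (simp add: kf_F_def matrix_vector_mult_add_rdistrib inner_add_right
          inner_matrix_vector[of u Z] matrix_vector_mul_assoc[symmetric])
    ultimately show ?thesis
      by (simp add: matrix_vector_mult_diff_distrib inner_diff_left inner_diff_right)
  qed
  show ?thesis using 1 2 3 unfolding gain_def x_def[symmetric] g_def[symmetric] by simp
qed

lemma step_le:
  assumes "pos_semidef P"
  shows "w \<bullet> (step P *v w) \<le> w \<bullet> (Sh *v w) + u \<bullet> (Se *v u) +
    (transpose T *v w - transpose Z *v u) \<bullet> (P *v (transpose T *v w - transpose Z *v u))"
proof -
  have "0 \<le> (u - gain P w) \<bullet> (F P *v (u - gain P w))"
    using pos_def_imp_pos_semidef[OF pos_def_F[OF assms]] by (simp add: pos_semidef_def)
  then show ?thesis using step_quadratic[OF assms, of w u] by linarith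
qed

text \<open>At the optimal input the square vanishes, and the next dual state is the transposed
  closed loop matrix applied to w.\<close>

lemma step_gain:
  assumes "pos_semidef P"
  shows "w \<bullet> (step P *v w) = w \<bullet> (Sh *v w) + gain P w \<bullet> (Se *v gain P w) +
    (transpose (T ** L P) *v w) \<bullet> (P *v (transpose (T ** L P) *v w))"
proof -
  have "transpose (T ** L P) *v w = transpose T *v w - transpose Z *v gain P w"
    by (simp add: gain_def kf_L_def matrix_transpose_mul transpose_diff matrix_diff_rdistrib
        matrix_vector_mult_diff_rdistrib matrix_vector_mul_assoc matrix_mul_assoc)
  then show ?thesis using step_quadratic[OF assms, of w "gain P w"] by simp
qed

lemma pos_semidef_step:
  assumes "pos_semidef P"
  shows "pos_semidef (step P)"
proof -
  have "transpose (step P) = step P"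
    using assms Sh P_mult_transpose_L(2)[OF assms]
    by (simp add: riccati_step_def pos_semidef_def transpose_add matrix_transpose_mul
        flip: matrix_mul_assoc)
  moreover have "0 \<le> w \<bullet> (step P *v w)" for w
    unfolding step_gain[OF assms]
    using assms Sh pos_def_imp_pos_semidef[OF Se] by (simp add: pos_semidef_def)
  ultimately show ?thesis by (simp add: pos_semidef_def)
qed

lemma pos_semidef_iterate: "pos_semidef P \<Longrightarrow> pos_semidef ((step ^^ t) P)"
  by (induction t) (simp_all add: pos_semidef_step)

lemma step_mono:
  assumes "pos_semidef P" "pos_semidef Q" and le: "\<And>w. w \<bullet> (P *v w) \<le> w \<bullet> (Q *v w)"
  shows "w \<bullet> (step P *v w) \<le> w \<bullet> (step Q *v w)"
  using step_le[OF assms(1), of w "gain Q w"] step_quadratic[OF assms(2), of w "gain Q w"]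
    le[of "transpose T *v w - transpose Z *v gain Q w"] by simp

text \<open>Expanding \<open>L P ** (P - Q) ** transpose (L Q)\<close> produces two mixed terms, one
  with P and one with Q. Both equal \<open>K P ** Se ** transpose (K Q)\<close>, so they cancel, and
  what remains is the difference of the two updated variances.\<close>

lemma step_diff:
  assumes "pos_semidef P" "pos_semidef Q"
  shows "step P - step Q = (T ** L P) ** (P - Q) ** transpose (T ** L Q)"
proof -
  have sQ: "transpose Q = Q" and sS: "transpose Se = Se"
    using assms(2) Se by (simp_all add: pos_semidef_def pos_def_def)
  have PZ: "L P ** P ** transpose (K Q ** Z) = K P ** Se ** transpose (K Q)"
    using L_mult_P_mult_transpose_Z[OF assms(1)] by (simp add: matrix_transpose_mul matrix_mul_assoc)
  have "Z ** Q ** transpose (L Q) = Se ** transpose (K Q)"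
    using arg_cong[OF L_mult_P_mult_transpose_Z[OF assms(2)], of transpose]
    by (simp add: matrix_transpose_mul sQ sS matrix_mul_assoc)
  then have ZQ: "K P ** Z ** Q ** transpose (L Q) = K P ** Se ** transpose (K Q)"
    by (simp flip: matrix_mul_assoc)
  have "L P ** (P - Q) ** transpose (L Q) =
      L P ** P ** transpose (L Q) - L P ** Q ** transpose (L Q)"
    by (simp add: matrix_diff_ldistrib matrix_diff_rdistrib)
  also have "L P ** P ** transpose (L Q) = L P ** P - L P ** P ** transpose (K Q ** Z)"
    by (simp add: kf_L_def[of Z Se Q] transpose_diff matrix_diff_ldistrib)
  also have "L P ** Q ** transpose (L Q) = Q ** transpose (L Q) - K P ** Z ** Q ** transpose (L Q)"
    by (simp add: kf_L_def[of Z Se P] matrix_diff_rdistrib)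
  finally have "L P ** (P - Q) ** transpose (L Q) = L P ** P - Q ** transpose (L Q)"
    by (simp add: PZ ZQ)
  then have "T ** (L P ** (P - Q) ** transpose (L Q)) ** transpose T =
      T ** (P ** transpose (L P) - Q ** transpose (L Q)) ** transpose T"
    using P_mult_transpose_L(2)[OF assms(1)] by simp
  then show ?thesis
    by (simp add: riccati_step_def matrix_diff_ldistrib matrix_diff_rdistrib matrix_transpose_mul
        matrix_mul_assoc)
qed

text \<open>The coercivity constant of \<open>Se\<close> serves every \<open>F A\<close> with A
  positive semidefinite, since \<open>Z ** A ** transpose Z\<close> only adds to the form. This is
  the uniform bound under which inversion is continuous.\<close>

lemma tendsto_K:
  assumes "\<And>t. pos_semidef (X t)" "pos_semidef P" "X \<longlonglongrightarrow> P"
  shows "(\<lambda>t. K (X t)) \<longlonglongrightarrow> K P"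
proof -
  obtain c where c: "c > 0" "\<And>x. c * (norm x)\<^sup>2 \<le> x \<bullet> (Se *v x)"
    using pos_def_lower_bound[OF Se] by blast
  have "c * (norm x)\<^sup>2 \<le> x \<bullet> (F A *v x)" if "pos_semidef A" for A x
  proof -
    have "0 \<le> x \<bullet> ((Z ** A ** transpose Z) *v x)"
      using pos_semidef_congruence[OF that, of Z] by (simp add: pos_semidef_def)
    then show ?thesis
      using c(2)[of x] by (simp add: kf_F_def matrix_vector_mult_add_rdistrib inner_add_right)
  qed
  moreover have "(\<lambda>t. F (X t)) \<longlonglongrightarrow> F P"
    unfolding kf_F_def by (intro tendsto_intros assms)
  ultimately have "(\<lambda>t. matrix_inv (F (X t))) \<longlonglongrightarrow> matrix_inv (F P)"
    using assms c(1) by (intro tendsto_matrix_inv) auto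
  then show ?thesis unfolding kf_K_def by (intro tendsto_intros assms)
qed

lemma tendsto_L:
  assumes "\<And>t. pos_semidef (X t)" "pos_semidef P" "X \<longlonglongrightarrow> P"
  shows "(\<lambda>t. L (X t)) \<longlonglongrightarrow> L P"
  unfolding kf_L_def by (intro tendsto_intros tendsto_K assms)

lemma tendsto_step:
  assumes "\<And>t. pos_semidef (X t)" "pos_semidef P" "X \<longlonglongrightarrow> P"
  shows "(\<lambda>t. step (X t)) \<longlonglongrightarrow> step P"
  unfolding riccati_step_def by (intro tendsto_intros tendsto_L assms)

end

subsection \<open>Convergence of the Riccati recursion\<close>

text \<open>The rank conditions in dual form. \<open>observable\<close>: suitable inputs drive any w
  to zero in \<open>n\<close> steps. \<open>controllable\<close>: only the zero vector has a free
  orbit whose first \<open>n\<close> points are all annihilated by \<open>transpose R\<close>. Later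
  \<open>n\<close> becomes the dimension of the state.\<close>

locale regular_riccati = riccati Z T Se Sh
  for Z :: "real^'p^'d" and T :: "real^'p^'p" and Se :: "real^'d^'d" and Sh :: "real^'p^'p" +
  fixes R :: "real^'r^'p" and Q :: "real^'r^'r" and n :: nat
  assumes Sh_eq: "Sh = R ** Q ** transpose R" and Q: "pos_def Q"
    and observable: "\<And>w. \<exists>c. matpow (transpose T) n *v w =
      (\<Sum>k<n. matpow (transpose T) k *v (transpose Z *v c k))"
    and controllable: "\<And>w. (\<And>k. k < n \<Longrightarrow> transpose R *v (matpow (transpose T) k *v w) = 0) \<Longrightarrow> w = 0"
begin

text \<open>Observability lets the inputs \<open>c\<close> steer \<open>w\<close> to zero in finitely many steps, and
  \<open>step_le\<close> then bounds the variance by the cost of these inputs.\<close>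

lemma bounded_if_steerable:
  assumes "matpow (transpose T) m *v w = (\<Sum>k<m. matpow (transpose T) k *v (transpose Z *v c k))"
  shows "\<exists>C. \<forall>t. w \<bullet> ((step ^^ t) 0 *v w) \<le> C"
  using assms
proof (induction m arbitrary: w)
  case 0
  then show ?case by auto
next
  case (Suc m)
  \<comment> \<open>The coefficient with the highest index is the input applied first; the remaining
    \<open>m\<close> inputs steer the new state \<open>w'\<close> to zero.\<close>
  define w' where "w' = transpose T *v w - transpose Z *v c m"
  have "matpow (transpose T) m *v w' = (\<Sum>k<m. matpow (transpose T) k *v (transpose Z *v c k))"
    using Suc.prems unfolding w'_def matpow_vec_Suc by (simp add: matrix_vector_mult_diff_distrib)
  then obtain C where C: "\<And>t. w' \<bullet> ((step ^^ t) 0 *v w') \<le> C"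
    using Suc.IH by blast
  define D where "D = w \<bullet> (Sh *v w) + c m \<bullet> (Se *v c m) + C"
  \<comment> \<open>The 0 in the maximum covers \<open>t = 0\<close>, where the iterate is the zero
    matrix and no step has been made.\<close>
  have "w \<bullet> ((step ^^ t) 0 *v w) \<le> max 0 D" for t
  proof (cases t)
    case (Suc s)
    have "w \<bullet> ((step ^^ t) 0 *v w) \<le>
        w \<bullet> (Sh *v w) + c m \<bullet> (Se *v c m) + w' \<bullet> ((step ^^ s) 0 *v w')"
      using step_le[OF pos_semidef_iterate[OF pos_semidef_zero], where u = "c m"]
      by (simp add: Suc w'_def)
    then show ?thesis using C[of s] unfolding D_def by linarith
  qed simp
  then show ?case by blast
qed

lemma step_fixed_point:
  obtains P where "pos_semidef P" "step P = P"
proof -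
  define X where "X t = (step ^^ t) 0" for t
  have psd: "pos_semidef (X t)" for t
    unfolding X_def by (intro pos_semidef_iterate pos_semidef_zero)
  have X_Suc: "X (Suc t) = step (X t)" for t by (simp add: X_def)
  have mono: "w \<bullet> (X t *v w) \<le> w \<bullet> (X (Suc t) *v w)" for t w
  proof (induction t arbitrary: w)
    case 0
    then show ?case using psd[of 1] by (simp add: X_def pos_semidef_def)
  next
    case (Suc t)
    show ?case unfolding X_Suc by (rule step_mono[OF psd psd[of "Suc t", unfolded X_Suc] Suc[unfolded X_Suc]])
  qed
  have "convergent (\<lambda>t. w \<bullet> (X t *v w))" for w
  proof -
    obtain c where c: "matpow (transpose T) n *v w =
      (\<Sum>k<n. matpow (transpose T) k *v (transpose Z *v c k))"
      using observable by blast
    obtain C where "\<And>t. w \<bullet> (X t *v w) \<le> C"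
      using bounded_if_steerable[OF c] unfolding X_def by blast
    moreover have "incseq (\<lambda>t. w \<bullet> (X t *v w))" using mono by (intro incseq_SucI)
    ultimately show ?thesis using incseq_convergent convergentI by metis
  qed
  moreover have "\<And>t. transpose (X t) = X t" using psd by (simp add: pos_semidef_def)
  ultimately obtain P where lim: "X \<longlonglongrightarrow> P"
    using convergent_symmetric_matrix convergent_def by blast
  have P: "pos_semidef P" using pos_semidef_limit[OF psd lim] .
  have "(\<lambda>t. X (Suc t)) \<longlonglongrightarrow> step P" unfolding X_Suc by (rule tendsto_step[OF psd P lim])
  then have "step P = P" using LIMSEQ_Suc[OF lim] LIMSEQ_unique by blast
  with P show ?thesis using that by blast
qed

text \<open>\<open>G\<close> is a Gramian: its form sums the squared sizes of the vectors seen along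
  the free orbit. Controllability makes it positive definite, hence coercive, so that small
  observations force a small state.\<close>

lemma tendsto_zero_if_controllable:
  assumes "\<And>k. (\<lambda>t. transpose R *v (matpow (transpose T) k *v z t)) \<longlonglongrightarrow> 0"
  shows "z \<longlonglongrightarrow> 0"
proof -
  define A where "A k = transpose R ** matpow (transpose T) k" for k
  define G where "G = (\<Sum>k<n. transpose (A k) ** A k)"
  have G: "w \<bullet> (G *v w) = (\<Sum>k<n. (norm (A k *v w))\<^sup>2)" for w
  proof -
    have "G *v w = (\<Sum>k<n. (transpose (A k) ** A k) *v w)"
      unfolding G_def by (rule bounded_bilinear.sum_left[OF bounded_bilinear_matrix_vector_mult])
    then show ?thesis
      by (simp add: inner_sum_right inner_matrix_vector[of _ "transpose _"] power2_norm_eq_inner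
          matrix_vector_mul_assoc[symmetric])
  qed
  have "pos_def G"
    unfolding pos_def_def
  proof (intro conjI allI impI)
    show "transpose G = G"
      unfolding G_def linear_sum[OF bounded_linear.linear[OF bounded_linear_transpose]]
      by (simp add: matrix_transpose_mul)
    fix w :: "real^'p" assume "w \<noteq> 0"
    then obtain k where "k < n" "A k *v w \<noteq> 0"
      using controllable[of w] by (auto simp: A_def matrix_vector_mul_assoc)
    then show "0 < w \<bullet> (G *v w)"
      unfolding G by (intro sum_pos2[of _ k]) auto
  qed
  then obtain c where c: "c > 0" "\<And>w. c * (norm w)\<^sup>2 \<le> w \<bullet> (G *v w)"
    using pos_def_lower_bound by blast
  have "(\<lambda>t. z t \<bullet> (G *v z t)) \<longlonglongrightarrow> (\<Sum>k<n. (norm (0 :: real^'r))\<^sup>2)"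
    unfolding G A_def matrix_vector_mul_assoc[symmetric] by (intro tendsto_intros assms)
  then have "(\<lambda>t. z t \<bullet> (G *v z t)) \<longlonglongrightarrow> 0" by simp
  with c show ?thesis by (rule tendsto_zero_of_norm_square_le)
qed

lemma closed_loop_stable:
  assumes P: "pos_semidef P" and fixed: "step P = P"
  shows "matpow (transpose (T ** L P)) \<longlonglongrightarrow> 0"
proof (rule tendsto_matrixI)
  fix w
  define z where "z t = matpow (transpose (T ** L P)) t *v w" for t
  define g where "g t = gain P (z t)" for t
  define q where "q t = z t \<bullet> (P *v z t)" for t
  define r where "r t = transpose R *v z t" for t
  have z_Suc: "z (Suc t) = transpose (T ** L P) *v z t" for t
    by (simp add: z_def matrix_vector_mul_assoc)
  have z_Suc': "z (Suc t) = transpose T *v z t - transpose Z *v g t" for t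
    by (simp add: z_Suc g_def gain_def kf_L_def matrix_transpose_mul transpose_diff
        matrix_diff_rdistrib matrix_vector_mult_diff_rdistrib matrix_vector_mul_assoc matrix_mul_assoc)
  \<comment> \<open>At a fixed point \<open>step_gain\<close> is an energy balance: what the form of
    P loses in one step is exactly the cost paid in that step.\<close>
  have decr: "q t - q (Suc t) = r t \<bullet> (Q *v r t) + g t \<bullet> (Se *v g t)" for t
    using step_gain[OF P, of "z t"] unfolding fixed
    by (simp add: q_def r_def g_def z_Suc Sh_eq inner_matrix_vector[of _ R]
        matrix_vector_mul_assoc[symmetric])
  obtain c where c: "c > 0" "\<And>x. c * (norm x)\<^sup>2 \<le> x \<bullet> (Se *v x)"
    using pos_def_lower_bound[OF Se] by blast
  obtain d where d: "d > 0" "\<And>x. d * (norm x)\<^sup>2 \<le> x \<bullet> (Q *v x)"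
    using pos_def_lower_bound[OF Q] by blast
  have nonneg: "0 \<le> c * (norm (g t))\<^sup>2" "0 \<le> d * (norm (r t))\<^sup>2" for t
    using c(1) d(1) by simp_all
  have le: "c * (norm (g t))\<^sup>2 \<le> q t - q (Suc t)" "d * (norm (r t))\<^sup>2 \<le> q t - q (Suc t)" for t
    using decr[of t] c(2)[of "g t"] d(2)[of "r t"] nonneg[of t] by linarith+
  have "decseq q"
    by (rule decseq_SucI) (use le(1) nonneg(1) in \<open>smt (verit)\<close>)
  moreover have "0 \<le> q t" for t using P by (simp add: q_def pos_semidef_def)
  ultimately obtain l where "q \<longlonglongrightarrow> l" using decseq_convergent by metis
  then have "(\<lambda>t. q t - q (Suc t)) \<longlonglongrightarrow> l - l" by (intro tendsto_diff LIMSEQ_Suc)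
  then have dq: "(\<lambda>t. q t - q (Suc t)) \<longlonglongrightarrow> 0" by simp
  have g0: "g \<longlonglongrightarrow> 0" by (rule tendsto_zero_of_norm_square_le[OF c(1) le(1) dq])
  have r0: "r \<longlonglongrightarrow> 0" by (rule tendsto_zero_of_norm_square_le[OF d(1) le(2) dq])
  \<comment> \<open>The closed loop orbit is a free orbit driven by the inputs \<open>g\<close>,
    which vanish. Over any fixed number of steps the two therefore agree in the limit, and the decay
    of \<open>r\<close> passes to the free orbit, to which controllability refers.\<close>
  have open_loop: "(\<lambda>t. matpow (transpose T) k *v z t - z (t + k)) \<longlonglongrightarrow> 0" for k
  proof (induction k)
    case (Suc k)
    have "matpow (transpose T) (Suc k) *v z t - z (t + Suc k) =
        transpose T *v (matpow (transpose T) k *v z t - z (t + k)) + transpose Z *v g (t + k)" for t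
      by (simp add: z_Suc' matrix_vector_mult_diff_distrib matrix_vector_mul_assoc)
    moreover have "(\<lambda>t. transpose T *v (matpow (transpose T) k *v z t - z (t + k))
        + transpose Z *v g (t + k)) \<longlonglongrightarrow> transpose T *v 0 + transpose Z *v 0"
      by (intro tendsto_intros Suc LIMSEQ_ignore_initial_segment g0)
    ultimately show ?case by simp
  qed simp
  have "(\<lambda>t. transpose R *v (matpow (transpose T) k *v z t)) \<longlonglongrightarrow> 0" for k
  proof -
    have "transpose R *v (matpow (transpose T) k *v z t) =
        transpose R *v (matpow (transpose T) k *v z t - z (t + k)) + r (t + k)" for t
      by (simp add: r_def matrix_vector_mult_diff_distrib)
    moreover have "(\<lambda>t. transpose R *v (matpow (transpose T) k *v z t - z (t + k)) + r (t + k))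
        \<longlonglongrightarrow> transpose R *v 0 + 0"
      by (intro tendsto_intros open_loop LIMSEQ_ignore_initial_segment r0)
    ultimately show ?thesis by simp
  qed
  then have "z \<longlonglongrightarrow> 0" by (rule tendsto_zero_if_controllable)
  then show "(\<lambda>t. matpow (transpose (T ** L P)) t *v w) \<longlonglongrightarrow> 0 *v w"
    by (simp add: z_def[abs_def])
qed

text \<open>By \<open>step_diff\<close>, the difference of two solutions is multiplied by both closed loop
  matrices in each step; one of the products is bounded, the other one tends to zero.\<close>

lemma riccati_tendsto:
  fixes \<Phi> :: "nat \<Rightarrow> real^'p^'p"
  assumes P1: "pos_semidef P1" and P: "pos_semidef P" and fixed: "step P = P"
    and \<Phi>: "\<Phi> 0 = mat 1" "\<And>t. \<Phi> (Suc t) = (T ** L ((step ^^ t) P1)) ** \<Phi> t"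
    and bounded: "\<And>t. norm (\<Phi> t) \<le> B"
  shows "(\<lambda>t. (step ^^ t) P1) \<longlonglongrightarrow> P"
proof -
  define N where "N = transpose (T ** L P)"
  \<comment> \<open>The left factors vary in time and accumulate with the newest outermost; on the
    right only powers of the constant matrix \<open>N\<close> occur.\<close>
  have diff: "(step ^^ t) P1 - P = \<Phi> t ** ((P1 - P) ** matpow N t)" for t
  proof (induction t)
    case (Suc t)
    have "(step ^^ Suc t) P1 - P = step ((step ^^ t) P1) - step P" by (simp add: fixed)
    also have "\<dots> = (T ** L ((step ^^ t) P1)) ** ((step ^^ t) P1 - P) ** N"
      unfolding N_def by (rule step_diff[OF pos_semidef_iterate[OF P1] P])
    finally show ?case unfolding Suc matpow_Suc_right \<Phi> by (simp add: matrix_mul_assoc)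
  qed (simp add: \<Phi>)
  have N0: "(\<lambda>t. (P1 - P) ** matpow N t) \<longlonglongrightarrow> (P1 - P) ** 0"
    unfolding N_def by (intro tendsto_intros closed_loop_stable P fixed)
  have "Bseq \<Phi>" using bounded by (intro BseqI')
  then have "(\<lambda>t. \<Phi> t ** ((P1 - P) ** matpow N t)) \<longlonglongrightarrow> 0"
    using bounded_bilinear.Bfun_prod_Zfun[OF bounded_bilinear_matrix_mult] N0
    by (simp add: tendsto_Zfun_iff)
  then show ?thesis unfolding diff[symmetric] by (rule LIM_zero_cancel)
qed

end

subsection \<open>Asymptotically time-invariant linear recursions\<close>

lemma linear_iterate: "linear B \<Longrightarrow> linear (B ^^ k)"
  for B :: "'a::real_vector \<Rightarrow> 'a"
proof (induction k)
  case 0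
  then show ?case by (simp add: linear_iff)
next
  case (Suc k)
  show ?case unfolding funpow.simps by (rule linear_compose[OF Suc.IH[OF Suc.prems] Suc.prems])
qed

text \<open>The finitely many basis vectors become small at a common time N, and the coordinates of
  x are bounded by its norm; so pointwise decay is uniform on the unit ball.\<close>

lemma stable_iterate_contraction:
  fixes B :: "'a::euclidean_space \<Rightarrow> 'a"
  assumes "linear B" and stable: "\<And>x. (\<lambda>k. (B ^^ k) x) \<longlonglongrightarrow> 0"
  obtains N where "\<And>x. norm ((B ^^ N) x) \<le> norm x / 2"
proof -
  have lim: "(\<lambda>k. \<Sum>b\<in>Basis. norm ((B ^^ k) b)) \<longlonglongrightarrow> (\<Sum>b\<in>(Basis :: 'a set). norm (0 :: 'a))"
    by (intro tendsto_intros stable)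
  from order_tendstoD(2)[OF lim, of "1 / 2"] obtain N where N: "(\<Sum>b\<in>Basis. norm ((B ^^ N) b)) < 1 / 2"
    by (auto simp: eventually_sequentially)
  have "norm ((B ^^ N) x) \<le> norm x / 2" for x
  proof -
    have "(B ^^ N) x = (B ^^ N) (\<Sum>b\<in>Basis. (x \<bullet> b) *\<^sub>R b)" by (simp add: euclidean_representation)
    also have "\<dots> = (\<Sum>b\<in>Basis. (x \<bullet> b) *\<^sub>R (B ^^ N) b)"
      using linear_iterate[OF \<open>linear B\<close>] by (simp add: linear_sum linear_cmul)
    also have "norm \<dots> \<le> (\<Sum>b\<in>Basis. norm x * norm ((B ^^ N) b))"
      by (intro sum_norm_le) (simp add: Basis_le_norm mult_right_mono)
    also have "\<dots> \<le> norm x * (1 / 2)"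
      unfolding sum_distrib_left[symmetric] using N by (intro mult_left_mono) auto
    finally show ?thesis by simp
  qed
  then show ?thesis using that by blast
qed

lemma contracting_recursion_tendsto_0:
  fixes a :: "nat \<Rightarrow> real"
  assumes nonneg: "\<And>t. 0 \<le> a t" and r: "0 \<le> r" "r < 1"
    and step: "\<forall>\<^sub>F t in sequentially. a (Suc t) \<le> r * a t + d t" and d: "d \<longlonglongrightarrow> 0"
  shows "a \<longlonglongrightarrow> 0"
proof -
  have "\<forall>\<^sub>F t in sequentially. a t < e" if "e > 0" for e
  proof -
    define e' where "e' = e / 2"
    have e': "e' > 0" "e' < e" using that by (simp_all add: e'_def)
    have "\<forall>\<^sub>F t in sequentially. d t < (1 - r) * e'"
      using r e' by (intro order_tendstoD[OF d]) simp
    with step have "\<forall>\<^sub>F t in sequentially. a (Suc t) \<le> r * a t + d t \<and> d t < (1 - r) * e'"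
      by (rule eventually_conj)
    then obtain m where m: "\<And>t. t \<ge> m \<Longrightarrow> a (Suc t) \<le> r * a t + d t \<and> d t < (1 - r) * e'"
      by (auto simp: eventually_sequentially)
    \<comment> \<open>Since \<open>r * e' + (1 - r) * e' = e'\<close>, the level \<open>e'\<close>
      absorbs the disturbance, and the excess over it is reduced by the factor \<open>r\<close> in
      each step.\<close>
    have geo: "a (m + k) - e' \<le> r ^ k * a m" for k
    proof (induction k)
      case (Suc k)
      have "a (m + Suc k) - e' \<le> r * (a (m + k) - e')"
        using m[of "m + k"] by (simp add: algebra_simps)
      also have "\<dots> \<le> r * (r ^ k * a m)" using Suc r by (intro mult_left_mono)
      finally show ?case by simp
    qed (use e' in simp)
    have lim: "(\<lambda>k. r ^ k * a m) \<longlonglongrightarrow> 0 * a m"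
      using r by (intro tendsto_intros LIMSEQ_power_zero) simp
    have "\<forall>\<^sub>F k in sequentially. r ^ k * a m < e - e'"
      using order_tendstoD(2)[OF lim, of "e - e'"] e' by simp
    then have "\<forall>\<^sub>F k in sequentially. a (k + m) < e"
      by eventually_elim (use geo in \<open>smt (verit) add.commute\<close>)
    then show ?thesis using eventually_sequentially_seg[of "\<lambda>t. a t < e" m] by blast
  qed
  then show ?thesis
    using nonneg by (intro order_tendstoI) (auto intro: always_eventually less_le_trans)
qed

text \<open>In the norm \<open>\<Sum>k<N. norm ((B ^^ k) x)\<close> the limit map \<open>B\<close> itself is a strict contraction.\<close>

lemma perturbed_recursion_tendsto_0:
  fixes B :: "'a::euclidean_space \<Rightarrow> 'a" and x :: "nat \<Rightarrow> 'a"
  assumes "linear B" and stable: "\<And>x. (\<lambda>k. (B ^^ k) x) \<longlonglongrightarrow> 0"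
    and rec: "\<And>t. norm (x (Suc t) - B (x t)) \<le> \<epsilon> t * norm (x t) + \<delta> t"
    and \<epsilon>: "\<epsilon> \<longlonglongrightarrow> 0" and \<delta>: "\<delta> \<longlonglongrightarrow> 0"
  shows "x \<longlonglongrightarrow> 0"
proof (cases "\<forall>x :: 'a. x = 0")
  case True
  then have "x = (\<lambda>t. 0)" by auto
  then show ?thesis by simp
next
  case False
  then obtain x0 :: 'a where "x0 \<noteq> 0" by blast
  obtain N where N: "\<And>x. norm ((B ^^ N) x) \<le> norm x / 2"
    using stable_iterate_contraction[OF assms(1,2)] by blast
  \<comment> \<open>For \<open>N = 0\<close> the bound would say that \<open>x0\<close> has at most
    half its own norm. With \<open>N\<close> positive, \<open>p\<close> contains the term
    \<open>k = 0\<close> and dominates the norm.\<close>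
  have "N \<noteq> 0" using N[of x0] \<open>x0 \<noteq> 0\<close> by (auto intro: ccontr)
  define p where "p x = (\<Sum>k<N. norm ((B ^^ k) x))" for x
  have p_ge: "norm x \<le> p x" for x
    using member_le_sum[of 0 "{..<N}" "\<lambda>k. norm ((B ^^ k) x)"] \<open>N \<noteq> 0\<close> by (simp add: p_def)
  have "\<exists>c. \<forall>x. norm ((B ^^ k) x) \<le> c * norm x" for k
    using linear_bounded[OF linear_iterate[OF \<open>linear B\<close>]] by blast
  then obtain c where c: "\<And>k x. norm ((B ^^ k) x) \<le> c k * norm x" by metis
  define C where "C = max 1 (\<Sum>k<N. c k)"
  have "C \<ge> 1" by (simp add: C_def)
  have p_le: "p x \<le> C * norm x" for x
  proof -
    have "p x \<le> (\<Sum>k<N. c k) * norm x" unfolding p_def sum_distrib_right by (intro sum_mono c)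
    also have "\<dots> \<le> C * norm x" by (intro mult_right_mono) (simp_all add: C_def)
    finally show ?thesis .
  qed
  have p_triangle: "p (x + y) \<le> p x + p y" for x y
    unfolding p_def sum.distrib[symmetric]
    using linear_iterate[OF \<open>linear B\<close>] by (intro sum_mono) (simp add: linear_add norm_triangle_ineq)
  \<comment> \<open>Applying \<open>B\<close> shifts the sum: the term \<open>norm x\<close> drops
    out and \<open>norm ((B ^^ N) x)\<close>, at most half of it, comes in. The equivalence of
    \<open>p\<close> with the norm turns the loss \<open>norm x / 2\<close> into a relative loss of
    at least \<open>1 / (2 * C)\<close>.\<close>
  have p_B: "p (B x) \<le> (1 - 1 / (2 * C)) * p x" for x
  proof -
    have "p (B x) + norm x = (\<Sum>k<Suc N. norm ((B ^^ k) x))"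
      unfolding p_def by (subst sum.lessThan_Suc_shift) (simp add: funpow_swap1)
    also have "\<dots> \<le> p x + norm x / 2" using N by (simp add: p_def)
    finally have "p (B x) \<le> p x - norm x / 2" by simp
    moreover have "p x / C \<le> norm x" using p_le[of x] \<open>C \<ge> 1\<close> by (simp add: divide_le_eq mult.commute)
    ultimately show ?thesis by (simp add: algebra_simps)
  qed
  \<comment> \<open>Half of the relative loss \<open>1 / (2 * C)\<close> is kept; the other half
    pays for the perturbation once \<open>C * \<epsilon> t < 1 / (4 * C)\<close>.\<close>
  define r where "r = 1 - 1 / (4 * C)"
  have r: "0 \<le> r" "r < 1" using \<open>C \<ge> 1\<close> by (simp_all add: r_def divide_le_eq)
  have lim: "(\<lambda>t. C * \<epsilon> t) \<longlonglongrightarrow> C * 0" by (intro tendsto_intros \<epsilon>)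
  have "\<forall>\<^sub>F t in sequentially. C * \<epsilon> t < 1 / (4 * C)"
    using order_tendstoD(2)[OF lim, of "1 / (4 * C)"] \<open>C \<ge> 1\<close> by simp
  then have "\<forall>\<^sub>F t in sequentially. p (x (Suc t)) \<le> r * p (x t) + C * \<delta> t"
  proof eventually_elim
    case (elim t)
    have "p (x (Suc t)) \<le> p (B (x t)) + p (x (Suc t) - B (x t))"
      using p_triangle[of "B (x t)" "x (Suc t) - B (x t)"] by simp
    also have "\<dots> \<le> (1 - 1 / (2 * C)) * p (x t) + C * (\<epsilon> t * norm (x t) + \<delta> t)"
      using \<open>C \<ge> 1\<close> rec[of t] p_le[of "x (Suc t) - B (x t)"]
      by (intro add_mono p_B) (meson dual_order.trans mult_left_mono zero_le_one)
    also have "C * (\<epsilon> t * norm (x t) + \<delta> t) \<le> 1 / (4 * C) * p (x t) + C * \<delta> t"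
    proof -
      have "C * \<epsilon> t * norm (x t) \<le> 1 / (4 * C) * norm (x t)"
        using elim by (intro mult_right_mono) auto
      also have "\<dots> \<le> 1 / (4 * C) * p (x t)"
        using \<open>C \<ge> 1\<close> by (intro mult_left_mono p_ge) auto
      finally show ?thesis by (simp add: algebra_simps)
    qed
    also have "(1 - 1 / (2 * C)) * p (x t) + (1 / (4 * C) * p (x t) + C * \<delta> t) = r * p (x t) + C * \<delta> t"
      by (simp add: r_def algebra_simps)
    finally show ?case by simp
  qed
  moreover have "(\<lambda>t. C * \<delta> t) \<longlonglongrightarrow> 0" using tendsto_mult_left[OF \<delta>, of C] by simp
  moreover have "0 \<le> p (x t)" for t by (simp add: p_def sum_nonneg)
  ultimately have "(\<lambda>t. p (x t)) \<longlonglongrightarrow> 0"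
    using r by (intro contracting_recursion_tendsto_0[of "\<lambda>t. p (x t)" r "\<lambda>t. C * \<delta> t"])
  then show ?thesis
    by (rule Lim_null_comparison[OF always_eventually[OF allI], rotated]) (rule p_ge)
qed

text \<open>The limit must solve \<open>l = B l + c'\<close>. A vector fixed by \<open>B\<close>
  would not decay, so identity minus \<open>B\<close> is injective and, in finite dimension, onto;
  thus \<open>l\<close> exists. The deviation from \<open>l\<close> satisfies a recursion whose
  disturbance, \<open>A t l - B l\<close> plus \<open>c t - c'\<close>, vanishes in the
  limit.\<close>

lemma perturbed_recursion_convergent:
  fixes B :: "'a::euclidean_space \<Rightarrow> 'a" and x :: "nat \<Rightarrow> 'a"
  assumes "linear B" and stable: "\<And>x. (\<lambda>k. (B ^^ k) x) \<longlonglongrightarrow> 0"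
    and lin: "\<And>t. linear (A t)"
    and A: "\<And>t x. norm (A t x - B x) \<le> \<epsilon> t * norm x" and \<epsilon>: "\<epsilon> \<longlonglongrightarrow> 0"
    and rec: "\<And>t. x (Suc t) = A t (x t) + c t" and c: "c \<longlonglongrightarrow> c'"
  obtains l where "x \<longlonglongrightarrow> l" "l = B l + c'"
proof -
  have "linear (\<lambda>x. x - B x)" using \<open>linear B\<close> by (intro linear_compose_sub) (auto simp: linear_iff)
  moreover have "x = 0" if "x - B x = 0" for x
  proof -
    have "(B ^^ k) x = x" for k using that by (induction k) simp_all
    then show ?thesis using stable[of x] LIMSEQ_unique by fastforce
  qed
  ultimately have "surj (\<lambda>x. x - B x)"
    by (intro linear_injective_imp_surjective) (auto simp: linear_injective_0)
  then obtain l where l: "c' = l - B l" by (metis surjD)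
  define e where "e t = x t - l" for t
  have "e \<longlonglongrightarrow> 0"
  proof (rule perturbed_recursion_tendsto_0[OF assms(1,2) _ \<epsilon>])
    show "(\<lambda>t. \<epsilon> t * norm l + norm (c t - c')) \<longlonglongrightarrow> 0"
      using tendsto_add[OF tendsto_mult_right[OF \<epsilon>, of "norm l"] tendsto_norm[OF tendsto_diff[OF c tendsto_const[of c']]]]
      by simp
    fix t
    have "e (Suc t) - B (e t) = (A t (e t) - B (e t)) + ((A t l - B l) + (c t - c'))"
      using lin[of t] by (simp add: e_def rec l linear_diff)
    also have "norm \<dots> \<le> norm (A t (e t) - B (e t)) + (norm (A t l - B l) + norm (c t - c'))"
      by (intro norm_triangle_le add_left_mono norm_triangle_ineq)
    also have "\<dots> \<le> \<epsilon> t * norm (e t) + (\<epsilon> t * norm l + norm (c t - c'))"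
      using A[of t "e t"] A[of t l] by simp
    finally show "norm (e (Suc t) - B (e t)) \<le> \<epsilon> t * norm (e t) + (\<epsilon> t * norm l + norm (c t - c'))" .
  qed
  then have "x \<longlonglongrightarrow> l" unfolding e_def by (rule LIM_zero_cancel)
  moreover have "l = B l + c'" using l by simp
  ultimately show ?thesis using that by blast
qed

lemma perturbed_vector_recursion:
  fixes A :: "nat \<Rightarrow> real^'n^'n" and x :: "nat \<Rightarrow> real^'n"
  assumes A: "A \<longlonglongrightarrow> B" and stable: "matpow B \<longlonglongrightarrow> 0"
    and rec: "\<And>t. x (Suc t) = A t *v x t"
  shows "x \<longlonglongrightarrow> 0"
proof -
  obtain c where c: "\<And>(X :: real^'n^'n) x. norm (X *v x) \<le> norm X * norm x * c"
    using bounded_bilinear.bounded[OF bounded_bilinear_matrix_vector_mult] by blast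
  have iterates: "(\<lambda>k. ((*v) B ^^ k) y) \<longlonglongrightarrow> 0" for y
  proof -
    have "((*v) B ^^ k) y = matpow B k *v y" for k
      by (induction k) (simp_all add: matrix_vector_mul_assoc)
    moreover have "(\<lambda>k. matpow B k *v y) \<longlonglongrightarrow> 0 *v y" by (intro tendsto_intros stable)
    ultimately show ?thesis by simp
  qed
  have lim: "(\<lambda>t. norm (A t - B) * c) \<longlonglongrightarrow> 0"
    using tendsto_mult_right[OF tendsto_norm[OF LIM_zero[OF A]], of c] by simp
  show ?thesis
  proof (rule perturbed_recursion_tendsto_0[OF matrix_vector_mul_linear iterates _ lim])
    show "norm (x (Suc t) - B *v x t) \<le> norm (A t - B) * c * norm (x t) + 0" for t
      using c[of "A t - B" "x t"] by (simp add: rec matrix_vector_mult_diff_rdistrib mult_ac)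
  qed simp
qed

text \<open>The recursion is linear on the Euclidean space of matrices. Its limit map X \<mapsto> B
  X B^T has the iterates B^k X (B^k)^T and so inherits stability from B.\<close>

lemma perturbed_lyapunov_recursion:
  fixes A V :: "nat \<Rightarrow> real^'n^'n"
  assumes A: "A \<longlonglongrightarrow> B" and stable: "matpow B \<longlonglongrightarrow> 0"
    and rec: "\<And>t. V (Suc t) = A t ** V t ** transpose (A t) + C t" and C: "C \<longlonglongrightarrow> C'"
  shows "convergent V"
proof -
  have lin: "linear (\<lambda>X. D ** X ** transpose D)" for D :: "real^'n^'n"
    by (intro linearI) (simp_all add: matrix_add_ldistrib matrix_add_rdistrib
        bounded_bilinear.scaleR_left[OF bounded_bilinear_matrix_mult]
        bounded_bilinear.scaleR_right[OF bounded_bilinear_matrix_mult])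
  obtain c where c: "c > 0" "\<And>(X :: real^'n^'n) (Y :: real^'n^'n). norm (X ** Y) \<le> norm X * norm Y * c"
    using bounded_bilinear.pos_bounded[OF bounded_bilinear_matrix_mult] by blast
  \<comment> \<open>One term for each half of A X A^T - B X B^T = (A - B) X A^T + B X (A -
    B)^T.\<close>
  define \<epsilon> where
    "\<epsilon> t = norm (A t - B) * norm (transpose (A t)) * c * c + norm B * norm (transpose (A t - B)) * c * c" for t
  have 3: "norm (X ** Y ** W) \<le> norm X * norm W * c * c * norm Y" for X Y W :: "real^'n^'n"
  proof -
    have "norm (X ** Y ** W) \<le> norm (X ** Y) * norm W * c" by (rule c(2))
    also have "\<dots> \<le> norm X * norm Y * c * norm W * c"
      using c(1) by (intro mult_right_mono c(2)) auto
    finally show ?thesis by (simp add: mult_ac)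
  qed
  have "(\<lambda>k. ((\<lambda>X. B ** X ** transpose B) ^^ k) Y) \<longlonglongrightarrow> 0" for Y
  proof -
    have "((\<lambda>X. B ** X ** transpose B) ^^ k) Y = matpow B k ** Y ** transpose (matpow B k)" for k
      by (induction k) (simp_all add: matrix_transpose_mul matrix_mul_assoc)
    moreover have "(\<lambda>k. matpow B k ** Y ** transpose (matpow B k)) \<longlonglongrightarrow> 0 ** Y ** transpose 0"
      by (intro tendsto_intros stable)
    ultimately show ?thesis by simp
  qed
  moreover have "\<epsilon> \<longlonglongrightarrow> norm (B - B) * norm (transpose B) * c * c + norm B * norm (transpose (B - B)) * c * c"
    unfolding \<epsilon>_def by (intro tendsto_intros A)
  then have "\<epsilon> \<longlonglongrightarrow> 0" by simp
  moreover have "norm (A t ** X ** transpose (A t) - B ** X ** transpose B) \<le> \<epsilon> t * norm X" for t X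
  proof -
    have "A t ** X ** transpose (A t) - B ** X ** transpose B =
        (A t - B) ** X ** transpose (A t) + B ** X ** transpose (A t - B)"
      by (simp add: transpose_diff matrix_diff_ldistrib matrix_diff_rdistrib)
    also have "norm \<dots> \<le> \<epsilon> t * norm X"
      unfolding \<epsilon>_def distrib_right by (intro norm_triangle_le add_mono 3)
    finally show ?thesis .
  qed
  ultimately obtain l where "V \<longlonglongrightarrow> l"
    using perturbed_recursion_convergent[OF lin _ lin _ _ rec C] by metis
  then show ?thesis by (rule convergentI)
qed

subsection \<open>Square integrable random vectors\<close>

text \<open>The integral of a non-integrable function is 0 by convention; finite second moments make
  the entries of \<open>cov_matrix\<close> genuine covariances, so that it is bilinear.\<close>

definition square_integrable_vec :: "'w measure \<Rightarrow> ('w \<Rightarrow> real^'n) \<Rightarrow> bool" where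
  "square_integrable_vec M X \<longleftrightarrow> X \<in> borel_measurable M \<and> integrable M (\<lambda>\<omega>. (norm (X \<omega>))\<^sup>2)"

lemma integrable_dominated:
  fixes f g :: "'w \<Rightarrow> real"
  assumes "integrable M g" "f \<in> borel_measurable M" "\<And>\<omega>. \<bar>f \<omega>\<bar> \<le> g \<omega>"
  shows "integrable M f"
  by (rule Bochner_Integration.integrable_bound[OF assms(1,2)], rule AE_I2)
    (use assms(3) in \<open>metis abs_ge_self order_trans real_norm_def\<close>)

text \<open>The model equations hold on \<open>space M\<close> only, so random vectors are replaced
  there rather than as functions.\<close>

lemma cov_matrix_cong:
  assumes "\<And>\<omega>. \<omega> \<in> space M \<Longrightarrow> X \<omega> = X' \<omega>" "\<And>\<omega>. \<omega> \<in> space M \<Longrightarrow> Y \<omega> = Y' \<omega>"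
  shows "cov_matrix M X Y = cov_matrix M X' Y'"
proof -
  have "integral\<^sup>L M X = integral\<^sup>L M X'" "integral\<^sup>L M Y = integral\<^sup>L M Y'"
    by (intro Bochner_Integration.integral_cong refl assms; simp)+
  then show ?thesis
    unfolding cov_matrix_def using assms
    by (auto simp: vec_eq_iff intro!: Bochner_Integration.integral_cong)
qed

lemma square_integrable_vec_cong:
  assumes "\<And>\<omega>. \<omega> \<in> space M \<Longrightarrow> X \<omega> = X' \<omega>"
  shows "square_integrable_vec M X = square_integrable_vec M X'"
  unfolding square_integrable_vec_def
  using assms measurable_cong[of M X X' borel]
    Bochner_Integration.integrable_cong[of M M "\<lambda>\<omega>. (norm (X \<omega>))\<^sup>2" "\<lambda>\<omega>. (norm (X' \<omega>))\<^sup>2"]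
  by simp

lemma cov_matrix_swap: "cov_matrix M X Y = transpose (cov_matrix M Y X)"
  by (simp add: cov_matrix_def transpose_def mult.commute)

lemma square_integrable_vec_mult:
  assumes "square_integrable_vec M X"
  shows "square_integrable_vec M (\<lambda>\<omega>. A *v X \<omega>)"
proof -
  obtain c where c: "\<And>x. norm (A *v x) \<le> c * norm x"
    using linear_bounded[OF matrix_vector_mul_linear] by blast
  have [measurable]: "X \<in> borel_measurable M" using assms by (simp add: square_integrable_vec_def)
  have "continuous_on UNIV ((*v) A)" by (intro continuous_intros)
  then have m: "(\<lambda>\<omega>. A *v X \<omega>) \<in> borel_measurable M"
    using borel_measurable_continuous_on[of "(*v) A" X] by simp
  then have m2: "(\<lambda>\<omega>. (norm (A *v X \<omega>))\<^sup>2) \<in> borel_measurable M" by simp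
  have "integrable M (\<lambda>\<omega>. c\<^sup>2 * (norm (X \<omega>))\<^sup>2)"
    using assms by (simp add: square_integrable_vec_def)
  moreover have "\<bar>(norm (A *v X \<omega>))\<^sup>2\<bar> \<le> c\<^sup>2 * (norm (X \<omega>))\<^sup>2" for \<omega>
    using power_mono[OF c[of "X \<omega>"], of 2] by (simp add: power_mult_distrib)
  ultimately have "integrable M (\<lambda>\<omega>. (norm (A *v X \<omega>))\<^sup>2)"
    by (intro integrable_dominated[OF _ m2])
  with m show ?thesis by (simp add: square_integrable_vec_def)
qed

lemma square_integrable_vec_add:
  assumes "square_integrable_vec M X" "square_integrable_vec M Y"
  shows "square_integrable_vec M (\<lambda>\<omega>. X \<omega> + Y \<omega>)"
proof -
  have [measurable]: "X \<in> borel_measurable M" "Y \<in> borel_measurable M"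
    using assms by (simp_all add: square_integrable_vec_def)
  have m: "(\<lambda>\<omega>. X \<omega> + Y \<omega>) \<in> borel_measurable M" by simp
  then have m2: "(\<lambda>\<omega>. (norm (X \<omega> + Y \<omega>))\<^sup>2) \<in> borel_measurable M" by simp
  have "integrable M (\<lambda>\<omega>. 2 * (norm (X \<omega>))\<^sup>2 + 2 * (norm (Y \<omega>))\<^sup>2)"
    using assms by (simp add: square_integrable_vec_def)
  moreover have "\<bar>(norm (X \<omega> + Y \<omega>))\<^sup>2\<bar> \<le> 2 * (norm (X \<omega>))\<^sup>2 + 2 * (norm (Y \<omega>))\<^sup>2" for \<omega>
    using power_mono[OF norm_triangle_ineq[of "X \<omega>" "Y \<omega>"], of 2]
      sum_squares_bound[of "norm (X \<omega>)" "norm (Y \<omega>)"]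
    by (simp add: power2_sum)
  ultimately have "integrable M (\<lambda>\<omega>. (norm (X \<omega> + Y \<omega>))\<^sup>2)"
    by (intro integrable_dominated[OF _ m2])
  with m show ?thesis by (simp add: square_integrable_vec_def)
qed

lemma square_integrable_vec_integrable_mult:
  assumes "square_integrable_vec M X" "square_integrable_vec M Y"
  shows "integrable M (\<lambda>\<omega>. X \<omega> $ i * Y \<omega> $ j)"
proof -
  have [measurable]: "X \<in> borel_measurable M" "Y \<in> borel_measurable M"
    using assms by (simp_all add: square_integrable_vec_def)
  have "continuous_on UNIV (\<lambda>x :: real^'c. x $ k)" for k by (intro continuous_intros)
  then have "(\<lambda>\<omega>. X \<omega> $ i) \<in> borel_measurable M" "(\<lambda>\<omega>. Y \<omega> $ j) \<in> borel_measurable M"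
    using borel_measurable_continuous_on[of "\<lambda>x. x $ i" X] borel_measurable_continuous_on[of "\<lambda>x. x $ j" Y]
    by (simp_all add: continuous_on_component)
  then have m: "(\<lambda>\<omega>. X \<omega> $ i * Y \<omega> $ j) \<in> borel_measurable M" by simp
  have "integrable M (\<lambda>\<omega>. (norm (X \<omega>))\<^sup>2 + (norm (Y \<omega>))\<^sup>2)"
    using assms by (simp add: square_integrable_vec_def)
  moreover have "\<bar>X \<omega> $ i * Y \<omega> $ j\<bar> \<le> (norm (X \<omega>))\<^sup>2 + (norm (Y \<omega>))\<^sup>2" for \<omega>
  proof -
    have "\<bar>X \<omega> $ i * Y \<omega> $ j\<bar> \<le> norm (X \<omega>) * norm (Y \<omega>)"
      unfolding abs_mult by (intro mult_mono component_le_norm_cart) auto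
    also have "\<dots> \<le> (norm (X \<omega>))\<^sup>2 + (norm (Y \<omega>))\<^sup>2"
      using sum_squares_bound[of "norm (X \<omega>)" "norm (Y \<omega>)"]
        mult_nonneg_nonneg[OF norm_ge_zero norm_ge_zero, of "X \<omega>" "Y \<omega>"]
      by linarith
    finally show ?thesis .
  qed
  ultimately show ?thesis by (intro integrable_dominated[OF _ m])
qed

context prob_space
begin

lemma square_integrable_vec_const: "square_integrable_vec M (\<lambda>_. c)"
  by (simp add: square_integrable_vec_def)

lemma square_integrable_vec_integrable:
  assumes "square_integrable_vec M X"
  shows "integrable M X"
proof -
  have m [measurable]: "X \<in> borel_measurable M" using assms by (simp add: square_integrable_vec_def)
  have "integrable M (\<lambda>\<omega>. norm (X \<omega>))"
    by (rule square_integrable_imp_integrable) (use assms in \<open>simp_all add: square_integrable_vec_def\<close>)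
  with m show ?thesis by (simp add: integrable_norm_iff)
qed

lemma expectation_nth:
  assumes "square_integrable_vec M X"
  shows "(LINT \<omega>|M. X \<omega>) $ i = (LINT \<omega>|M. X \<omega> $ i)"
  by (rule integral_bounded_linear[symmetric, OF bounded_linear_vec_nth
      square_integrable_vec_integrable[OF assms]])

lemma expectation_mult:
  assumes "square_integrable_vec M X"
  shows "(LINT \<omega>|M. A *v X \<omega>) = A *v (LINT \<omega>|M. X \<omega>)"
  by (rule integral_bounded_linear[OF matrix_vector_mul_bounded_linear
      square_integrable_vec_integrable[OF assms]])

lemma expectation_add:
  assumes "square_integrable_vec M X" "square_integrable_vec M Y"
  shows "(LINT \<omega>|M. X \<omega> + Y \<omega>) = (LINT \<omega>|M. X \<omega>) + (LINT \<omega>|M. Y \<omega>)"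
  using assms by (intro Bochner_Integration.integral_add square_integrable_vec_integrable)

lemma square_integrable_vec_center:
  assumes "square_integrable_vec M X"
  shows "square_integrable_vec M (\<lambda>\<omega>. X \<omega> - (LINT \<omega>|M. X \<omega>))"
  using square_integrable_vec_add[OF assms square_integrable_vec_const[of "- (LINT \<omega>|M. X \<omega>)"]]
  by simp

lemma integrable_cov:
  assumes "square_integrable_vec M X" "square_integrable_vec M Y"
  shows "integrable M (\<lambda>\<omega>. (X \<omega> $ i - (LINT \<omega>|M. X \<omega>) $ i) * (Y \<omega> $ j - (LINT \<omega>|M. Y \<omega>) $ j))"
  using square_integrable_vec_integrable_mult[OF assms[THEN square_integrable_vec_center]]
  by simp

lemma cov_matrix_add_left:
  assumes "square_integrable_vec M X" "square_integrable_vec M Y" "square_integrable_vec M W"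
  shows "cov_matrix M (\<lambda>\<omega>. X \<omega> + Y \<omega>) W = cov_matrix M X W + cov_matrix M Y W"
  unfolding vec_eq_iff
proof (intro allI)
  fix i j
  have eq: "X \<omega> $ i + Y \<omega> $ i - (LINT \<omega>|M. X \<omega> + Y \<omega>) $ i =
      (X \<omega> $ i - (LINT \<omega>|M. X \<omega>) $ i) + (Y \<omega> $ i - (LINT \<omega>|M. Y \<omega>) $ i)" for \<omega>
    by (simp add: expectation_add[OF assms(1,2)])
  show "cov_matrix M (\<lambda>\<omega>. X \<omega> + Y \<omega>) W $ i $ j = (cov_matrix M X W + cov_matrix M Y W) $ i $ j"
    using integrable_cov[OF assms(1,3)] integrable_cov[OF assms(2,3)]
    by (simp add: cov_matrix_def eq distrib_right)
qed

lemma cov_matrix_mult_left: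
  assumes "square_integrable_vec M X" "square_integrable_vec M W"
  shows "cov_matrix M (\<lambda>\<omega>. A *v X \<omega>) W = A ** cov_matrix M X W"
  unfolding vec_eq_iff
proof (intro allI)
  fix i j
  have "(A *v X \<omega>) $ i - (LINT \<omega>|M. A *v X \<omega>) $ i =
      (\<Sum>k\<in>UNIV. A $ i $ k * (X \<omega> $ k - (LINT \<omega>|M. X \<omega>) $ k))" for \<omega>
    unfolding expectation_mult[OF assms(1)]
    by (simp add: matrix_vector_mult_def sum_subtractf right_diff_distrib)
  then show "cov_matrix M (\<lambda>\<omega>. A *v X \<omega>) W $ i $ j = (A ** cov_matrix M X W) $ i $ j"
    using integrable_cov[OF assms]
    by (simp add: cov_matrix_def matrix_matrix_mult_def sum_distrib_right mult.assoc)
qed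

lemma cov_matrix_add_right:
  assumes "square_integrable_vec M X" "square_integrable_vec M Y" "square_integrable_vec M W"
  shows "cov_matrix M W (\<lambda>\<omega>. X \<omega> + Y \<omega>) = cov_matrix M W X + cov_matrix M W Y"
  using cov_matrix_add_left[OF assms]
  unfolding cov_matrix_swap[of M W X] cov_matrix_swap[of M W Y] cov_matrix_swap[of M W "\<lambda>\<omega>. X \<omega> + Y \<omega>"]
  by (simp add: transpose_add)

lemma cov_matrix_mult_right:
  assumes "square_integrable_vec M X" "square_integrable_vec M W"
  shows "cov_matrix M W (\<lambda>\<omega>. A *v X \<omega>) = cov_matrix M W X ** transpose A"
  unfolding cov_matrix_swap[of M W X] cov_matrix_swap[of M W "\<lambda>\<omega>. A *v X \<omega>"]
  by (simp add: cov_matrix_mult_left[OF assms] matrix_transpose_mul)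

lemma cov_matrix_const: "cov_matrix M (\<lambda>_. c) W = 0"
  by (simp add: cov_matrix_def vec_eq_iff prob_space)

lemma cov_matrix_uncorrelated_sum:
  assumes "square_integrable_vec M X" "square_integrable_vec M Y" "uncorrelated M X Y"
  shows "cov_matrix M (\<lambda>\<omega>. A *v X \<omega> + B *v Y \<omega>) (\<lambda>\<omega>. A *v X \<omega> + B *v Y \<omega>) =
    A ** cov_matrix M X X ** transpose A + B ** cov_matrix M Y Y ** transpose B"
proof -
  have "uncorrelated M Y X" using assms(3) cov_matrix_swap[of M Y X] by simp
  then show ?thesis
    using assms
    by (simp add: cov_matrix_add_left cov_matrix_add_right cov_matrix_mult_left
        cov_matrix_mult_right square_integrable_vec_add square_integrable_vec_mult matrix_mul_assoc)
qed

lemma quadratic_cov_matrix: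
  assumes "square_integrable_vec M X"
  shows "c \<bullet> (cov_matrix M X X *v c) = (LINT \<omega>|M. (c \<bullet> X \<omega> - c \<bullet> (LINT \<omega>|M. X \<omega>))\<^sup>2)"
proof -
  define Y where "Y \<omega> i = X \<omega> $ i - (LINT \<omega>|M. X \<omega>) $ i" for \<omega> i
  have "c \<bullet> X \<omega> - c \<bullet> (LINT \<omega>|M. X \<omega>) = (\<Sum>i\<in>UNIV. c $ i * Y \<omega> i)" for \<omega>
    by (simp add: inner_vec_def Y_def right_diff_distrib sum_subtractf)
  then have "(c \<bullet> X \<omega> - c \<bullet> (LINT \<omega>|M. X \<omega>))\<^sup>2 =
      (\<Sum>i\<in>UNIV. \<Sum>j\<in>UNIV. (c $ i * c $ j) * (Y \<omega> i * Y \<omega> j))" for \<omega>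
    by (simp add: power2_eq_square sum_product mult_ac)
  moreover have "integrable M (\<lambda>\<omega>. Y \<omega> i * Y \<omega> j)" for i j
    unfolding Y_def by (rule integrable_cov[OF assms assms])
  ultimately have "(LINT \<omega>|M. (c \<bullet> X \<omega> - c \<bullet> (LINT \<omega>|M. X \<omega>))\<^sup>2) =
      (\<Sum>i\<in>UNIV. \<Sum>j\<in>UNIV. (c $ i * c $ j) * (LINT \<omega>|M. Y \<omega> i * Y \<omega> j))"
    by simp
  also have "\<dots> = c \<bullet> (cov_matrix M X X *v c)"
    unfolding inner_vec_def matrix_vector_mult_def cov_matrix_def Y_def
    by (auto simp: sum_distrib_left intro!: sum.cong)
  finally show ?thesis by simp
qed

end

subsection \<open>Moments of Gaussian vectors\<close>

lemma symmetric_matrix_eqI: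
  fixes A B :: "real^'n^'n"
  assumes A: "transpose A = A" and B: "transpose B = B"
    and q: "\<And>c. c \<bullet> (A *v c) = c \<bullet> (B *v c)"
  shows "A = B"
proof (rule matrix_eq_inner)
  fix x y
  show "x \<bullet> (A *v y) = x \<bullet> (B *v y)"
    using q[of "x + y"] q[of x] q[of y] symmetric_matrix_swap[OF A, of y x]
      symmetric_matrix_swap[OF B, of y x]
    by (simp add: matrix_vector_right_distrib inner_add_left inner_add_right inner_commute)
qed

text \<open>A positive variance is covered by the moments of the normal density, with the variance
  as its even moment of order 2 * 1; for \<open>v = 0\<close> the integrals are evaluations at the
  point m.\<close>

lemma normal_measure_moments:
  assumes "0 \<le> v"
  shows "integrable (normal_measure m v) (\<lambda>x. x)"
    and "(LINT x|normal_measure m v. x) = m"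
    and "integrable (normal_measure m v) (\<lambda>x. (x - m)\<^sup>2)"
    and "(LINT x|normal_measure m v. (x - m)\<^sup>2) = v"
proof -
  have pos: "0 < sqrt v" if "v \<noteq> 0" using assms that by simp
  have return: "integrable (return borel m) f" if "f \<in> borel_measurable borel" for f :: "real \<Rightarrow> real"
    using that by (simp add: integrable_iff_bounded nn_integral_return)
  note simps = normal_measure_def return integral_return integrable_density integral_density
  show "integrable (normal_measure m v) (\<lambda>x. x)"
    using integrable_normal_moment_nz_1[OF pos, of m] by (simp add: simps)
  show "(LINT x|normal_measure m v. x) = m"
    using integral_normal_moment_nz_1[OF pos, of m] by (simp add: simps)
  show "integrable (normal_measure m v) (\<lambda>x. (x - m)\<^sup>2)"
    using integrable_normal_moment[OF pos, of m 2] by (simp add: simps)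
  show "(LINT x|normal_measure m v. (x - m)\<^sup>2) = v"
    using integral_normal_moment_even[OF pos, of m 1] assms by (simp add: simps)
qed

context prob_space
begin

text \<open>The definition prescribes only the laws of the projections of X. Projections on axis
  vectors give integrability and the mean; the covariance matrix is identified with S because both
  are symmetric and have the same quadratic form.\<close>

lemma gaussian_vector_moments:
  assumes "gaussian_vector M X \<mu> S"
  shows "square_integrable_vec M X" "(LINT \<omega>|M. X \<omega>) = \<mu>" "cov_matrix M X X = S"
proof -
  have m [measurable]: "X \<in> borel_measurable M" and S: "pos_semidef S"
    and dist: "\<And>c. distr M borel (\<lambda>\<omega>. c \<bullet> X \<omega>) = normal_measure (c \<bullet> \<mu>) (c \<bullet> (S *v c))"
    using assms by (auto simp: gaussian_vector_def)
  have v: "0 \<le> c \<bullet> (S *v c)" for c using S by (simp add: pos_semidef_def)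
  have 1: "integrable M (\<lambda>\<omega>. c \<bullet> X \<omega>)" for c
    using normal_measure_moments(1)[OF v[of c], of "c \<bullet> \<mu>"]
    by (simp add: dist[symmetric] integrable_distr_eq)
  have 2: "(LINT \<omega>|M. c \<bullet> X \<omega>) = c \<bullet> \<mu>" for c
    using normal_measure_moments(2)[OF v[of c], of "c \<bullet> \<mu>"]
    by (simp add: dist[symmetric] integral_distr)
  have 3: "integrable M (\<lambda>\<omega>. (c \<bullet> X \<omega> - c \<bullet> \<mu>)\<^sup>2)" for c
    using normal_measure_moments(3)[OF v[of c], of "c \<bullet> \<mu>"]
    by (simp add: dist[symmetric] integrable_distr_eq)
  have 4: "(LINT \<omega>|M. (c \<bullet> X \<omega> - c \<bullet> \<mu>)\<^sup>2) = c \<bullet> (S *v c)" for c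
    using normal_measure_moments(4)[OF v[of c], of "c \<bullet> \<mu>"]
    by (simp add: dist[symmetric] integral_distr)
  have sq: "integrable M (\<lambda>\<omega>. (c \<bullet> X \<omega>)\<^sup>2)" for c
  proof -
    have "(c \<bullet> X \<omega>)\<^sup>2 = (c \<bullet> X \<omega> - c \<bullet> \<mu>)\<^sup>2 + (2 * (c \<bullet> \<mu>) * (c \<bullet> X \<omega>) - (c \<bullet> \<mu>)\<^sup>2)" for \<omega>
      by (simp add: power2_diff)
    then show ?thesis using 1 3 by simp
  qed
  have "(norm x)\<^sup>2 = (\<Sum>i\<in>UNIV. (axis i 1 \<bullet> x)\<^sup>2)" for x :: "real^'b"
    unfolding power2_norm_eq_inner by (simp add: inner_vec_def[of x x] inner_axis' power2_eq_square)
  then show X: "square_integrable_vec M X"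
    using sq by (simp add: square_integrable_vec_def)
  show E: "(LINT \<omega>|M. X \<omega>) = \<mu>"
    using 2[of "axis _ 1"] by (simp add: vec_eq_iff expectation_nth[OF X] inner_axis')
  show "cov_matrix M X X = S"
  proof (rule symmetric_matrix_eqI)
    show "transpose (cov_matrix M X X) = cov_matrix M X X" by (rule cov_matrix_swap[symmetric])
    show "transpose S = S" using S by (simp add: pos_semidef_def)
  qed (simp add: quadratic_cov_matrix[OF X] E 4)
qed

end

subsection \<open>The rank conditions\<close>

lemma bij_betw_rank_pos: "bij_betw (rank_pos :: 'p::{finite,linorder} \<Rightarrow> nat) UNIV {..<CARD('p)}"
proof -
  have mono: "rank_pos i < rank_pos j" if "i < j" for i j :: 'p
    unfolding rank_pos_def using that by (intro psubset_card_mono) auto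
  have inj: "inj (rank_pos :: 'p \<Rightarrow> nat)"
    by (rule injI) (metis mono less_irrefl neqE)
  have "rank_pos k < CARD('p)" for k :: 'p
    unfolding rank_pos_def by (intro psubset_card_mono) auto
  then have "range (rank_pos :: 'p \<Rightarrow> nat) = {..<CARD('p)}"
    using inj by (intro card_subset_eq) (auto simp: card_image)
  with inj show ?thesis by (simp add: bij_betw_def)
qed

text \<open>Full column rank makes the transposed observability matrix onto. Its value at b is the
  sum on the right, where \<open>c k\<close> is the block of b that belongs to the k-th
  power.\<close>

lemma observability_surjective:
  fixes Z :: "('d::finite, 'p::{finite,linorder}) rmat" and T :: "('p, 'p) rmat"
  assumes "rank (obs_matrix Z T) = CARD('p)"
  shows "\<exists>c. w = (\<Sum>k<CARD('p). matpow (transpose T) k *v (transpose Z *v c k))"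
proof -
  have "surj ((*v) (transpose (obs_matrix Z T)))"
    using assms full_rank_surjective[of "transpose (obs_matrix Z T)"] rank_transpose[of "obs_matrix Z T"]
    by simp
  then obtain b where w: "w = transpose (obs_matrix Z T) *v b" by (metis surjD)
  define c :: "nat \<Rightarrow> (real, 'd) vec"
    where "c m = (\<chi> j. b $ (inv_into UNIV (rank_pos :: 'p \<Rightarrow> nat) m, j))" for m
  have c: "c (rank_pos k) $ j = b $ (k, j)" for k :: 'p and j
    using bij_betw_inv_into_left[OF bij_betw_rank_pos, of k] by (simp add: c_def)
  have "w $ i = (\<Sum>k\<in>(UNIV :: 'p set). transpose (Z ** matpow T (rank_pos k)) *v c (rank_pos k)) $ i" for i
  proof -
    have "w $ i = (\<Sum>kj\<in>UNIV \<times> UNIV. (Z ** matpow T (rank_pos (fst kj))) $ snd kj $ i * b $ kj)"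
      by (simp add: w matrix_vector_mult_def transpose_def obs_matrix_def)
    also have "\<dots> = (\<Sum>k\<in>UNIV. \<Sum>j\<in>UNIV. (Z ** matpow T (rank_pos k)) $ j $ i * b $ (k, j))"
      unfolding sum.cartesian_product by (simp add: case_prod_unfold)
    also have "\<dots> = (\<Sum>k\<in>(UNIV :: 'p set). transpose (Z ** matpow T (rank_pos k)) *v c (rank_pos k)) $ i"
      by (simp add: matrix_vector_mult_def transpose_def c)
    finally show ?thesis .
  qed
  then have "w = (\<Sum>k\<in>(UNIV :: 'p set). transpose (Z ** matpow T (rank_pos k)) *v c (rank_pos k))"
    by (simp add: vec_eq_iff)
  also have "\<dots> = (\<Sum>k<CARD('p). transpose (Z ** matpow T k) *v c k)"
    by (rule sum.reindex_bij_betw[OF bij_betw_rank_pos])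
  finally show ?thesis
    by (auto simp: matrix_transpose_mul transpose_matpow matrix_vector_mul_assoc intro!: exI[of _ c])
qed

text \<open>Full row rank makes the transposed controllability matrix injective, and the hypothesis
  says that each of its blocks annihilates w.\<close>

lemma controllability_injective:
  fixes T :: "('p::{finite,linorder}, 'p) rmat" and R :: "('p, 'r::finite) rmat"
  assumes "rank (ctrl_matrix T R) = CARD('p)"
    and null: "\<And>k. k < CARD('p) \<Longrightarrow> transpose R *v (matpow (transpose T) k *v w) = 0"
  shows "w = 0"
proof -
  have "inj ((*v) (transpose (ctrl_matrix T R)))"
    using assms(1) full_rank_injective[of "transpose (ctrl_matrix T R)"] rank_transpose[of "ctrl_matrix T R"]
    by simp
  moreover have "transpose (ctrl_matrix T R) *v w = transpose (ctrl_matrix T R) *v 0"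
  proof -
    have "(transpose (ctrl_matrix T R) *v w) $ (k, l) = 0" for k :: 'p and l
    proof -
      have "rank_pos k < CARD('p)" using bij_betw_rank_pos by (auto simp: bij_betw_def)
      then have "(transpose (matpow T (rank_pos k) ** R) *v w) $ l = 0"
        using null by (simp add: matrix_transpose_mul transpose_matpow matrix_vector_mul_assoc)
      then show ?thesis by (simp add: matrix_vector_mult_def transpose_def ctrl_matrix_def)
    qed
    then show ?thesis by (simp add: vec_eq_iff)
  qed
  ultimately show ?thesis by (rule injD)
qed

subsection \<open>The filter with bounded closed loop products\<close>

lemma (in regular_riccati) kf_P_tendsto:
  assumes P1: "pos_semidef P1"
    and bounded: "\<And>t k l. t \<ge> 1 \<Longrightarrow> k \<le> l \<Longrightarrow> l \<le> t - 1 \<Longrightarrow>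
      norm (ordprod (\<lambda>i. T ** L (kf_P Z T Se Sh P1 (t - i))) k l) \<le> B"
  obtains P where "pos_semidef P" "step P = P" "(\<lambda>t. kf_P Z T Se Sh P1 (Suc t)) \<longlonglongrightarrow> P"
proof -
  obtain P where P: "pos_semidef P" "step P = P" using step_fixed_point by blast
  \<comment> \<open>The product of the closed loop matrices at times t, t - 1, ..., 1. It is written
    with \<open>foldr\<close> because \<open>ordprod\<close> with lower index 0 has at least one
    factor, whereas \<open>\<Phi> 0\<close> must be empty.\<close>
  define \<Phi> where
    "\<Phi> t = foldr (\<lambda>i C. (T ** L (kf_P Z T Se Sh P1 (t - i))) ** C) [0..<t] (mat 1)" for t
  have \<Phi>_Suc: "\<Phi> (Suc t) = (T ** L ((step ^^ t) P1)) ** \<Phi> t" for t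
  proof -
    have "[0..<Suc t] = 0 # map Suc [0..<t]"
      by (simp add: map_Suc_upt upt_conv_Cons del: upt_Suc)
    then show ?thesis
      unfolding \<Phi>_def by (simp add: foldr_map comp_def kf_P_Suc del: upt_Suc kf_P.simps)
  qed
  \<comment> \<open>The assumed bound speaks of \<open>t \<ge> 1\<close>; the maximum adds the empty
    product.\<close>
  have "norm (\<Phi> t) \<le> max B (norm (mat 1 :: real^'p^'p))" for t
  proof (cases t)
    case (Suc s)
    then have "\<Phi> t = ordprod (\<lambda>i. T ** L (kf_P Z T Se Sh P1 (t - i))) 0 (t - 1)"
      by (simp add: \<Phi>_def ordprod_def)
    then show ?thesis using bounded[of t 0 "t - 1"] Suc by simp
  qed (simp add: \<Phi>_def)
  then have "(\<lambda>t. (step ^^ t) P1) \<longlonglongrightarrow> P"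
    using \<Phi>_Suc by (intro riccati_tendsto[OF P1 P, of \<Phi>]) (simp_all add: \<Phi>_def[of 0])
  with P show ?thesis using that by (simp add: kf_P_Suc del: kf_P.simps)
qed

text \<open>\<open>x n\<close> stands for the error at time \<open>Suc n\<close>, so the noises that
  enter next carry the index \<open>Suc n\<close>. It depends on earlier noises only; being
  uncorrelated with every noise of index above n, it contributes no mixed terms to the
  variance.\<close>

lemma (in prob_space) linear_recursion_moments:
  fixes x :: "nat \<Rightarrow> 'a \<Rightarrow> real^'p" and \<epsilon> :: "nat \<Rightarrow> 'a \<Rightarrow> real^'d" and \<eta> :: "nat \<Rightarrow> 'a \<Rightarrow> real^'p"
  assumes rec: "\<And>n \<omega>. \<omega> \<in> space M \<Longrightarrow> x (Suc n) \<omega> = A n *v x n \<omega> + (\<eta> (Suc n) \<omega> + G n *v \<epsilon> (Suc n) \<omega>)"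
    and x0: "square_integrable_vec M (x 0)" "\<And>s. s \<ge> 1 \<Longrightarrow> uncorrelated M (x 0) (\<epsilon> s)"
      "\<And>s. s \<ge> 1 \<Longrightarrow> uncorrelated M (x 0) (\<eta> s)"
    and \<epsilon>: "\<And>s. s \<ge> 1 \<Longrightarrow> square_integrable_vec M (\<epsilon> s)" "\<And>s. s \<ge> 1 \<Longrightarrow> (LINT \<omega>|M. \<epsilon> s \<omega>) = 0"
      "\<And>s. s \<ge> 1 \<Longrightarrow> cov_matrix M (\<epsilon> s) (\<epsilon> s) = Se"
    and \<eta>: "\<And>s. s \<ge> 1 \<Longrightarrow> square_integrable_vec M (\<eta> s)" "\<And>s. s \<ge> 1 \<Longrightarrow> (LINT \<omega>|M. \<eta> s \<omega>) = 0"
      "\<And>s. s \<ge> 1 \<Longrightarrow> cov_matrix M (\<eta> s) (\<eta> s) = Sh"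
    and uncorr: "\<And>s t. s \<ge> 1 \<Longrightarrow> t \<ge> 1 \<Longrightarrow> uncorrelated M (\<epsilon> s) (\<eta> t)"
      "\<And>s t. s \<ge> 1 \<Longrightarrow> t \<ge> 1 \<Longrightarrow> s \<noteq> t \<Longrightarrow> uncorrelated M (\<epsilon> s) (\<epsilon> t)"
      "\<And>s t. s \<ge> 1 \<Longrightarrow> t \<ge> 1 \<Longrightarrow> s \<noteq> t \<Longrightarrow> uncorrelated M (\<eta> s) (\<eta> t)"
  shows "square_integrable_vec M (x n)" and "s > n \<Longrightarrow> uncorrelated M (x n) (\<epsilon> s)"
    and "(LINT \<omega>|M. x (Suc n) \<omega>) = A n *v (LINT \<omega>|M. x n \<omega>)"
    and "cov_matrix M (x (Suc n)) (x (Suc n)) =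
      A n ** cov_matrix M (x n) (x n) ** transpose (A n) + (Sh + G n ** Se ** transpose (G n))"
proof -
  \<comment> \<open>The factors \<open>mat 1\<close> bring both sums into the form A X + B Y
    expected by \<open>cov_matrix_uncorrelated_sum\<close>.\<close>
  define N where "N n \<omega> = mat 1 *v \<eta> (Suc n) \<omega> + G n *v \<epsilon> (Suc n) \<omega>" for n \<omega>
  have rec': "x (Suc n) \<omega> = A n *v x n \<omega> + mat 1 *v N n \<omega>" if "\<omega> \<in> space M" for n \<omega>
    using rec[OF that] by (simp add: N_def)
  note sq = square_integrable_vec_add square_integrable_vec_mult
  have N: "square_integrable_vec M (N n)" for n
    unfolding N_def[abs_def] by (intro sq \<epsilon> \<eta>) simp_all
  have uncorr': "uncorrelated M (\<eta> s) (\<epsilon> t)" if "s \<ge> 1" "t \<ge> 1" for s t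
    using uncorr(1)[OF that(2,1)] cov_matrix_swap[of M "\<eta> s" "\<epsilon> t"] by simp
  have inv: "square_integrable_vec M (x n) \<and>
      (\<forall>s>n. uncorrelated M (x n) (\<epsilon> s) \<and> uncorrelated M (x n) (\<eta> s))" for n
  proof (induction n)
    case 0
    then show ?case using x0 by simp
  next
    case (Suc n)
    then have x: "square_integrable_vec M (x n)" by simp
    have x_Suc: "square_integrable_vec M (x (Suc n))"
      using square_integrable_vec_cong[of M "x (Suc n)", OF rec'] sq(1)[OF sq(2)[OF x] sq(2)[OF N]]
      by blast
    \<comment> \<open>W may have any dimension, so that one argument serves both noise
      sequences.\<close>
    have x_uncorr: "cov_matrix M (x (Suc n)) W = 0"
      if W: "square_integrable_vec M W" "uncorrelated M (x n) W"
        "uncorrelated M (\<eta> (Suc n)) W" "uncorrelated M (\<epsilon> (Suc n)) W" for W :: "'a \<Rightarrow> real^'c"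
    proof -
      have "cov_matrix M (x (Suc n)) W =
          cov_matrix M (\<lambda>\<omega>. A n *v x n \<omega> + (mat 1 *v \<eta> (Suc n) \<omega> + G n *v \<epsilon> (Suc n) \<omega>)) W"
        using rec' by (intro cov_matrix_cong) (simp_all add: N_def)
      also have "\<dots> = 0"
        using W x \<epsilon>(1)[of "Suc n"] \<eta>(1)[of "Suc n"]
        by (simp add: cov_matrix_add_left cov_matrix_mult_left sq del: matrix_vector_mul_lid)
      finally show ?thesis .
    qed
    have "uncorrelated M (x (Suc n)) (\<epsilon> s)" "uncorrelated M (x (Suc n)) (\<eta> s)" if "s > Suc n" for s
      using that Suc.IH by (auto intro!: x_uncorr \<epsilon>(1) \<eta>(1) uncorr uncorr')
    with x_Suc show ?case by simp
  qed
  then show x: "square_integrable_vec M (x n)" and "s > n \<Longrightarrow> uncorrelated M (x n) (\<epsilon> s)" by simp_all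
  have xN: "uncorrelated M (x n) (N n)"
  proof -
    have "cov_matrix M (x n) (N n) =
        cov_matrix M (x n) (\<eta> (Suc n)) ** transpose (mat 1) + cov_matrix M (x n) (\<epsilon> (Suc n)) ** transpose (G n)"
      unfolding N_def[abs_def] using x \<epsilon>(1)[of "Suc n"] \<eta>(1)[of "Suc n"]
      by (simp add: cov_matrix_add_right cov_matrix_mult_right sq del: matrix_vector_mul_lid transpose_mat)
    then show ?thesis using inv[of n] by simp
  qed
  have "(LINT \<omega>|M. N n \<omega>) = 0"
    unfolding N_def using \<epsilon>[of "Suc n"] \<eta>[of "Suc n"] by (simp add: expectation_add expectation_mult sq)
  moreover have "(LINT \<omega>|M. x (Suc n) \<omega>) = (LINT \<omega>|M. A n *v x n \<omega> + mat 1 *v N n \<omega>)"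
    using rec' by (intro Bochner_Integration.integral_cong) simp_all
  ultimately show "(LINT \<omega>|M. x (Suc n) \<omega>) = A n *v (LINT \<omega>|M. x n \<omega>)"
    using x N by (simp add: expectation_add expectation_mult sq)
  have "cov_matrix M (N n) (N n) = Sh + G n ** Se ** transpose (G n)"
    unfolding N_def[abs_def]
    by (subst cov_matrix_uncorrelated_sum) (simp_all add: \<epsilon> \<eta> uncorr')
  moreover have "cov_matrix M (x (Suc n)) (x (Suc n)) =
      cov_matrix M (\<lambda>\<omega>. A n *v x n \<omega> + mat 1 *v N n \<omega>) (\<lambda>\<omega>. A n *v x n \<omega> + mat 1 *v N n \<omega>)"
    using rec' by (intro cov_matrix_cong) simp_all
  ultimately show "cov_matrix M (x (Suc n)) (x (Suc n)) =
      A n ** cov_matrix M (x n) (x n) ** transpose (A n) + (Sh + G n ** Se ** transpose (G n))"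
    using cov_matrix_uncorrelated_sum[OF x N xN, of "A n" "mat 1"] by simp
qed

theorem theorem4p1:
  fixes M :: "'w measure"
    and blk :: "('p::{finite,linorder}) \<Rightarrow> 'd::{finite,linorder}"
    and Z :: "('d, 'p) rmat" and T :: "('p, 'p) rmat"
    and \<Sigma>\<epsilon> \<Sigma>\<epsilon>' :: "('d, 'd) rmat" and \<Sigma>\<eta> \<Sigma>\<eta>' :: "('p, 'p) rmat"
    and a\<^sub>1 a\<^sub>1' :: "'p rvec" and P\<^sub>1 P\<^sub>1' :: "('p, 'p) rmat"
    and y \<epsilon> :: "nat \<Rightarrow> 'w \<Rightarrow> 'd rvec" and \<alpha> \<eta> :: "nat \<Rightarrow> 'w \<Rightarrow> 'p rvec"
    and R :: "('p, 'r::finite) rmat" and Q :: "('r, 'r) rmat"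
    and R' :: "('p, 's::finite) rmat" and Q' :: "('s, 's) rmat"
    and P' L' :: "nat \<Rightarrow> ('p, 'p) rmat" and v' :: "nat \<Rightarrow> 'w \<Rightarrow> 'd rvec"
  assumes "prob_space M"
    \<comment> \<open>model\<close>
    and "mono blk" and "surj blk"
    and "block_diag id blk Z" and "block_diag blk blk T"
    and "\<forall>t\<ge>1. \<forall>\<omega>\<in>space M. y t \<omega> = Z *v \<alpha> t \<omega> + \<epsilon> t \<omega>"
    and "\<forall>t\<ge>1. \<forall>\<omega>\<in>space M. \<alpha> (t + 1) \<omega> = T *v \<alpha> t \<omega> + \<eta> t \<omega>"
    and "\<forall>t\<ge>1. gaussian_vector M (\<epsilon> t) 0 \<Sigma>\<epsilon>"
    and "\<forall>t\<ge>1. gaussian_vector M (\<eta> t) 0 \<Sigma>\<eta>"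
    and "gaussian_vector M (\<alpha> 1) a\<^sub>1 P\<^sub>1"
    and "jointly_gaussian M (\<alpha> 1) \<epsilon> \<eta>"
    and "\<forall>t\<ge>1. uncorrelated M (\<alpha> 1) (\<epsilon> t)"
    and "\<forall>t\<ge>1. uncorrelated M (\<alpha> 1) (\<eta> t)"
    and "\<forall>s\<ge>1. \<forall>t\<ge>1. uncorrelated M (\<epsilon> s) (\<eta> t)"
    and "\<forall>s\<ge>1. \<forall>t\<ge>1. s \<noteq> t \<longrightarrow> uncorrelated M (\<epsilon> s) (\<epsilon> t)"
    and "\<forall>s\<ge>1. \<forall>t\<ge>1. s \<noteq> t \<longrightarrow> uncorrelated M (\<eta> s) (\<eta> t)"
    \<comment> \<open>filter disregarding correlation\<close>
    and "\<Sigma>\<epsilon>' = block_part id id \<Sigma>\<epsilon>" and "\<Sigma>\<eta>' = block_part blk blk \<Sigma>\<eta>"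
    and "pos_semidef P\<^sub>1'" and "block_diag blk blk P\<^sub>1'"
    and "\<And>t. P' t = kf_P Z T \<Sigma>\<epsilon>' \<Sigma>\<eta>' P\<^sub>1' t"
    and "\<And>t. L' t = kf_L Z \<Sigma>\<epsilon>' (P' t)"
    and "\<And>t \<omega>. v' t \<omega> = kf_v Z T \<Sigma>\<epsilon>' \<Sigma>\<eta>' a\<^sub>1' P\<^sub>1' (\<lambda>s. y s \<omega>) t"
    \<comment> \<open>assumptions (1)--(4)\<close>
    and "pos_def \<Sigma>\<epsilon>" and "pos_def \<Sigma>\<epsilon>'"
    and "rank (obs_matrix Z T) = CARD('p)"
    and "\<Sigma>\<eta> = R ** Q ** transpose R" and "pos_def Q"
    and "rank (ctrl_matrix T R) = CARD('p)"
    and "\<Sigma>\<eta>' = R' ** Q' ** transpose R'" and "pos_def Q'"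
    and "rank (ctrl_matrix T R') = CARD('p)"
    and "\<exists>B>0. \<forall>t\<ge>1. \<forall>k l. k \<le> l \<and> l \<le> t - 1 \<longrightarrow>
           frob_norm (ordprod (\<lambda>i. T ** L' (t - i)) k l) \<le> B"
  shows "(\<lambda>t. LINT \<omega>|M. v' t \<omega>) \<longlonglongrightarrow> 0
    \<and> (\<exists>V :: ('d, 'd) rmat. (\<lambda>t. cov_matrix M (v' t) (v' t)) \<longlonglongrightarrow> V)"
proof -
  interpret prob_space M by fact
  note y_eq = assms(6) and \<alpha>_Suc = assms(7)
  have P'_eq: "P' = kf_P Z T \<Sigma>\<epsilon>' \<Sigma>\<eta>' P\<^sub>1'" and L'_eq: "L' = (\<lambda>t. kf_L Z \<Sigma>\<epsilon>' (P' t))"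
    using assms(21,22) by (auto simp: fun_eq_iff)
  \<comment> \<open>The Riccati theory is applied to the variances that the filter uses; the true
    ones return only with the moments of the error.\<close>
  interpret regular_riccati Z T \<Sigma>\<epsilon>' \<Sigma>\<eta>' R' Q' "CARD('p)"
  proof
    show "pos_semidef \<Sigma>\<eta>'"
      using \<open>\<Sigma>\<eta>' = R' ** Q' ** transpose R'\<close> \<open>pos_def Q'\<close>
      by (simp add: pos_semidef_congruence pos_def_imp_pos_semidef)
    show "\<exists>c. matpow (transpose T) CARD('p) *v w =
        (\<Sum>k<CARD('p). matpow (transpose T) k *v (transpose Z *v c k))" for w
      by (rule observability_surjective) fact
    show "w = 0" if "\<And>k. k < CARD('p) \<Longrightarrow> transpose R' *v (matpow (transpose T) k *v w) = 0" for w
      by (rule controllability_injective[OF _ that]) fact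
  qed fact+
  obtain B where B: "\<And>t k l. t \<ge> 1 \<Longrightarrow> k \<le> l \<Longrightarrow> l \<le> t - 1 \<Longrightarrow>
      norm (ordprod (\<lambda>i. T ** L (P' (t - i))) k l) \<le> B"
    using assms(33) by (auto simp: frob_norm_eq_norm L'_eq)
  obtain P where P: "pos_semidef P" "step P = P" and P_lim: "(\<lambda>t. P' (Suc t)) \<longlonglongrightarrow> P"
    using kf_P_tendsto[OF \<open>pos_semidef P\<^sub>1'\<close> B[unfolded P'_eq]] unfolding P'_eq by blast
  have psd: "pos_semidef (P' (Suc t))" for t
    unfolding P'_eq kf_P_Suc by (intro pos_semidef_iterate) fact
  define A where "A t = T ** L (P' (Suc t))" for t
  define G where "G t = - (T ** K (P' (Suc t)))" for t
  have A_lim: "A \<longlonglongrightarrow> T ** L P"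
    unfolding A_def[abs_def] by (intro tendsto_intros tendsto_L psd P P_lim)
  have G_lim: "G \<longlonglongrightarrow> - (T ** K P)"
    unfolding G_def[abs_def] by (intro tendsto_intros tendsto_K psd P P_lim)
  \<comment> \<open>Stability was obtained for the dual system; transposition is continuous and
    commutes with powers.\<close>
  have stable: "matpow (T ** L P) \<longlonglongrightarrow> 0"
    using tendsto_transpose[OF closed_loop_stable[OF P]] by (simp add: transpose_matpow)

  \<comment> \<open>The prediction error at time \<open>Suc t\<close>, so that index 0 belongs to
    the first real time.\<close>
  define x where "x t \<omega> = \<alpha> (Suc t) \<omega> - kf_a Z T \<Sigma>\<epsilon>' \<Sigma>\<eta>' a\<^sub>1' P\<^sub>1' (\<lambda>s. y s \<omega>) (Suc t)" for t \<omega>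
  have x_rec: "x (Suc t) \<omega> = A t *v x t \<omega> + (\<eta> (Suc t) \<omega> + G t *v \<epsilon> (Suc t) \<omega>)"
    if "\<omega> \<in> space M" for t \<omega>
  proof -
    define a where "a = kf_a Z T \<Sigma>\<epsilon>' \<Sigma>\<eta>' a\<^sub>1' P\<^sub>1' (\<lambda>s. y s \<omega>) (Suc t)"
    define H where "H = T ** K (P' (Suc t))"
    have "A t = T - H ** Z"
      by (simp add: A_def H_def kf_L_def matrix_diff_ldistrib matrix_mul_assoc)
    moreover have "x (Suc t) \<omega> = T *v \<alpha> (Suc t) \<omega> + \<eta> (Suc t) \<omega>
        - (T *v a + H *v (y (Suc t) \<omega> - Z *v a))"
    proof -
      have "\<alpha> (Suc (Suc t)) \<omega> = T *v \<alpha> (Suc t) \<omega> + \<eta> (Suc t) \<omega>" using \<alpha>_Suc that by auto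
      then show ?thesis
        unfolding x_def kf_a.simps(2)[of _ _ _ _ _ _ _ "Suc t"] a_def[symmetric]
        by (simp add: H_def P'_eq del: kf_a.simps kf_P.simps)
    qed
    moreover have "y (Suc t) \<omega> = Z *v \<alpha> (Suc t) \<omega> + \<epsilon> (Suc t) \<omega>" using y_eq that by auto
    moreover have "x t \<omega> = \<alpha> (Suc t) \<omega> - a" by (simp only: x_def a_def)
    moreover have "G t = - H" by (simp add: G_def H_def)
    moreover have "(- H) *v z = - (H *v z)" for z
      by (rule bounded_bilinear.minus_left[OF bounded_bilinear_matrix_vector_mult])
    ultimately show ?thesis
      by (simp add: matrix_vector_mult_diff_rdistrib matrix_vector_mult_diff_distrib
          matrix_vector_right_distrib matrix_vector_mul_assoc)
  qed
  have \<epsilon>: "square_integrable_vec M (\<epsilon> t)" "(LINT \<omega>|M. \<epsilon> t \<omega>) = 0" "cov_matrix M (\<epsilon> t) (\<epsilon> t) = \<Sigma>\<epsilon>"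
    if "t \<ge> 1" for t
    using gaussian_vector_moments assms(8) that by blast+
  have \<eta>: "square_integrable_vec M (\<eta> t)" "(LINT \<omega>|M. \<eta> t \<omega>) = 0" "cov_matrix M (\<eta> t) (\<eta> t) = \<Sigma>\<eta>"
    if "t \<ge> 1" for t
    using gaussian_vector_moments assms(9) that by blast+
  have \<alpha>: "square_integrable_vec M (\<alpha> 1)" using gaussian_vector_moments assms(10) by blast
  \<comment> \<open>The filter starts at a deterministic vector, so the initial error is
    \<open>\<alpha> 1\<close> up to a constant: its mean may be nonzero, but its covariances are
    those of \<open>\<alpha> 1\<close>.\<close>
  have x0: "x 0 = (\<lambda>\<omega>. \<alpha> 1 \<omega> + - a\<^sub>1')" by (simp add: x_def fun_eq_iff)
  have x0_sq: "square_integrable_vec M (x 0)"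
    unfolding x0 by (intro square_integrable_vec_add \<alpha> square_integrable_vec_const)
  have x0_cov: "cov_matrix M (x 0) W = cov_matrix M (\<alpha> 1) W"
    if "square_integrable_vec M W" for W :: "'w \<Rightarrow> (real, 'c::finite) vec"
    unfolding x0 by (simp only: cov_matrix_add_left[OF \<alpha> square_integrable_vec_const that]
        cov_matrix_const add_0_right)
  have x0_uncorr: "uncorrelated M (x 0) (\<epsilon> s)" "uncorrelated M (x 0) (\<eta> s)" if "s \<ge> 1" for s
    using that assms(12,13) x0_cov[OF \<epsilon>(1)[OF that]] x0_cov[OF \<eta>(1)[OF that]] by auto
  have uncorr: "uncorrelated M (\<epsilon> s) (\<eta> t)" "s \<noteq> t \<Longrightarrow> uncorrelated M (\<epsilon> s) (\<epsilon> t)"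
    "s \<noteq> t \<Longrightarrow> uncorrelated M (\<eta> s) (\<eta> t)" if "s \<ge> 1" "t \<ge> 1" for s t
    using that assms(14-16) by auto
  note moments = linear_recursion_moments[of x A \<eta> G \<epsilon> \<Sigma>\<epsilon> \<Sigma>\<eta>,
      OF x_rec x0_sq x0_uncorr \<epsilon> \<eta> uncorr]
  have x_sq: "square_integrable_vec M (x t)" for t by (rule moments)
  have x\<epsilon>: "uncorrelated M (x t) (\<epsilon> (Suc t))" for t by (rule moments) simp_all
  have x_mean: "(LINT \<omega>|M. x (Suc t) \<omega>) = A t *v (LINT \<omega>|M. x t \<omega>)" for t by (rule moments)
  have x_var: "cov_matrix M (x (Suc t)) (x (Suc t)) =
    A t ** cov_matrix M (x t) (x t) ** transpose (A t) + (\<Sigma>\<eta> + G t ** \<Sigma>\<epsilon> ** transpose (G t))" for t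
    by (rule moments)
  have mean_lim: "(\<lambda>t. LINT \<omega>|M. x t \<omega>) \<longlonglongrightarrow> 0"
    by (rule perturbed_vector_recursion[OF A_lim stable x_mean])
  \<comment> \<open>The forcing term combines the true noise variances with the gain of the filter,
    and converges because the gain does.\<close>
  have "(\<lambda>t. \<Sigma>\<eta> + G t ** \<Sigma>\<epsilon> ** transpose (G t)) \<longlonglongrightarrow>
      \<Sigma>\<eta> + (- (T ** K P)) ** \<Sigma>\<epsilon> ** transpose (- (T ** K P))"
    by (intro tendsto_intros G_lim)
  then have "convergent (\<lambda>t. cov_matrix M (x t) (x t))"
    by (rule perturbed_lyapunov_recursion[OF A_lim stable x_var])
  then obtain V where var_lim: "(\<lambda>t. cov_matrix M (x t) (x t)) \<longlonglongrightarrow> V"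
    by (auto simp: convergent_def)

  \<comment> \<open>The error at time \<open>Suc t\<close> is uncorrelated with the observation
    noise of that time, so the variance of this sum splits.\<close>
  have v'_eq: "v' (Suc t) \<omega> = Z *v x t \<omega> + mat 1 *v \<epsilon> (Suc t) \<omega>" if "\<omega> \<in> space M" for t \<omega>
    using y_eq that unfolding assms(23) kf_v_def x_def
    by (simp add: matrix_vector_mult_diff_distrib del: kf_a.simps)
  have "(LINT \<omega>|M. v' (Suc t) \<omega>) = Z *v (LINT \<omega>|M. x t \<omega>)" for t
  proof -
    have "(LINT \<omega>|M. v' (Suc t) \<omega>) = (LINT \<omega>|M. Z *v x t \<omega> + mat 1 *v \<epsilon> (Suc t) \<omega>)"
      by (intro Bochner_Integration.integral_cong refl v'_eq)
    then show ?thesis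
      using x_sq[of t] \<epsilon>[of "Suc t"] by (simp add: expectation_add expectation_mult square_integrable_vec_mult)
  qed
  moreover have "(\<lambda>t. Z *v (LINT \<omega>|M. x t \<omega>)) \<longlonglongrightarrow> Z *v 0" by (intro tendsto_intros mean_lim)
  ultimately have "(\<lambda>t. LINT \<omega>|M. v' (Suc t) \<omega>) \<longlonglongrightarrow> 0" by simp
  then have mean: "(\<lambda>t. LINT \<omega>|M. v' t \<omega>) \<longlonglongrightarrow> 0" by (rule LIMSEQ_imp_Suc)
  have "cov_matrix M (v' (Suc t)) (v' (Suc t)) = Z ** cov_matrix M (x t) (x t) ** transpose Z + \<Sigma>\<epsilon>" for t
  proof -
    have "cov_matrix M (v' (Suc t)) (v' (Suc t)) =
        cov_matrix M (\<lambda>\<omega>. Z *v x t \<omega> + mat 1 *v \<epsilon> (Suc t) \<omega>) (\<lambda>\<omega>. Z *v x t \<omega> + mat 1 *v \<epsilon> (Suc t) \<omega>)"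
      by (intro cov_matrix_cong v'_eq)
    then show ?thesis
      using cov_matrix_uncorrelated_sum[OF x_sq \<epsilon>(1) x\<epsilon>, of t Z "mat 1"] \<epsilon>(3)[of "Suc t"] by simp
  qed
  moreover have "(\<lambda>t. Z ** cov_matrix M (x t) (x t) ** transpose Z + \<Sigma>\<epsilon>) \<longlonglongrightarrow> Z ** V ** transpose Z + \<Sigma>\<epsilon>"
    by (intro tendsto_intros var_lim)
  ultimately have "(\<lambda>t. cov_matrix M (v' (Suc t)) (v' (Suc t))) \<longlonglongrightarrow> Z ** V ** transpose Z + \<Sigma>\<epsilon>" by simp
  then have "(\<lambda>t. cov_matrix M (v' t) (v' t)) \<longlonglongrightarrow> Z ** V ** transpose Z + \<Sigma>\<epsilon>" by (rule LIMSEQ_imp_Suc)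
  with mean show ?thesis by blast
qed

end
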